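(* Let $P$ be a simplicial $d$-polytope whose boundary complex $\Delta=\partial P$ is flag, and let $\Delta_0$ be its vertex set. Then, coefficientwise, \[(1+t)\sum_{v\in\Delta_0}h_{\mathrm{lk}_v\Delta}(t)\le f_0(\Delta)\,h_\Delta(t).\] Moreover, equality holds if and only if $\Delta$ is the boundary complex of the $d$-dimensional crosspolytope.
   Context: A simplicial complex is flag if its faces are exactly the cliques of its $1$-skeleton. $f_0(\Delta)$ is the number of vertices. The link of a vertex $v$ is $\mathrm{lk}_v\Delta=\{\tau\in\Delta: v\notin\tau,\ \tau\cup\{v\}\in\Delta\}$. For a $(k-1)$-dimensional complex $\Gamma$ with $f_{i-1}(\Gamma)$ faces of size $i$, its $h$-polynomial is $h_\Gamma(t)=\sum_{i=0}^k f_{i-1}(\Gamma)t^i(1-t)^{k-i}$ (so $\Delta$ has $k=d$ and each vertex link has $k=d-1$). *)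

theory Defs
  imports "HOL-Analysis.Analysis" "HOL-Computational_Algebra.Polynomial"
begin

text \<open>
  An abstract simplicial complex is represented by its set of faces, each face being a finite
  set of vertices; the empty face is included.
\<close>

definition vertices_of :: "'a set set \<Rightarrow> 'a set" where
  "vertices_of K = {v. {v} \<in> K}"

definition clique_of :: "'a set set \<Rightarrow> 'a set \<Rightarrow> bool" where
  "clique_of K \<sigma> \<longleftrightarrow> finite \<sigma> \<and> \<sigma> \<subseteq> vertices_of K \<and>
     (\<forall>u\<in>\<sigma>. \<forall>v\<in>\<sigma>. u \<noteq> v \<longrightarrow> {u, v} \<in> K)"

definition flag_complex :: "'a set set \<Rightarrow> bool" where
  "flag_complex K \<longleftrightarrow> (\<forall>\<sigma>. \<sigma> \<in> K \<longleftrightarrow> clique_of K \<sigma>)"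

definition vertex_link :: "'a set set \<Rightarrow> 'a \<Rightarrow> 'a set set" where
  "vertex_link K v = {\<tau> \<in> K. v \<notin> \<tau> \<and> insert v \<tau> \<in> K}"

text \<open>
  The number of faces with exactly \<open>i\<close> vertices, i.e. the entry with index \<open>i - 1\<close> of
  the \<open>f\<close>-vector.
\<close>

definition num_faces :: "'a set set \<Rightarrow> nat \<Rightarrow> nat" where
  "num_faces K i = card {\<sigma> \<in> K. card \<sigma> = i}"

text \<open>
  The \<open>h\<close>-polynomial of a complex of dimension \<open>k - 1\<close>; here \<open>[:0, 1:]\<close> is \<open>t\<close> and
  \<open>[:1, -1:]\<close> is \<open>1 - t\<close>.
\<close>

definition h_poly :: "nat \<Rightarrow> 'a set set \<Rightarrow> int poly" where
  "h_poly k K =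
     (\<Sum>i\<le>k. of_nat (num_faces K i) * [:0, 1:] ^ i * [:1, -1:] ^ (k - i))"

definition complex_iso :: "'a set set \<Rightarrow> 'b set set \<Rightarrow> bool" where
  "complex_iso K L \<longleftrightarrow>
     (\<exists>f. bij_betw f (vertices_of K) (vertices_of L) \<and> L = (\<lambda>\<sigma>. f ` \<sigma>) ` K)"

definition simplicial_polytope :: "'a::euclidean_space set \<Rightarrow> bool" where
  "simplicial_polytope P \<longleftrightarrow>
     polytope P \<and> (\<forall>F. F face_of P \<and> F \<noteq> P \<longrightarrow> (\<exists>n. n simplex F))"

text \<open>
  The faces of the boundary complex are the vertex sets of the proper faces of the polytope.
  The library counts \<open>{}\<close> as a face of every set; it yields the empty face of the complex.
\<close>

definition boundary_complex :: "'a::euclidean_space set \<Rightarrow> 'a set set" where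
  "boundary_complex P =
     {{v. v extreme_point_of F} | F. F face_of P \<and> F \<noteq> P}"

text \<open>
  The convex hull of \<open>d\<close> of the standard basis vectors and their negatives, inside an
  ambient space of dimension at least \<open>d\<close>. For \<open>d > 0\<close> the origin lies in that hull anyway;
  it is inserted so that for \<open>d = 0\<close> the crosspolytope is a single point.
\<close>

definition crosspolytope :: "nat \<Rightarrow> 'a::euclidean_space set \<Rightarrow> bool" where
  "crosspolytope d Q \<longleftrightarrow>
     (\<exists>B. B \<subseteq> Basis \<and> card B = d \<and> Q = convex hull (insert 0 (B \<union> uminus ` B)))"

end

theory Submission
  imports Defs "HOL-Library.Poly_Mapping"
begin

text \<open>
  For every vertex \<open>v\<close> one has \<open>(1 + t) h(lk v) \<le> h(\<Delta>)\<close> coefficientwise; summing over the vertices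
  gives the inequality. A line shelling in a direction close to \<open>- v\<close> shows that \<open>h(\<Delta>) - h(lk v)\<close>
  counts the facets avoiding \<open>v\<close> by the size of their restriction sets. By reversing the shelling, it
  suffices to prove \<open>h(lk v) \<le> h(B)\<close> for the ball \<open>B\<close> formed by these facets. Choose
  a linear system of parameters for \<open>B\<close> consisting of the linear functions vanishing at \<open>v\<close>
  and one form supported outside the link of \<open>v\<close>, which exists because \<open>\<Delta>\<close> is flag. Then the Artinian
  reduction of the face ring of \<open>B\<close> maps onto that of \<open>lk v\<close>.

  In the case of equality, comparing the coefficients of \<open>t\<close> shows that every vertex has exactly one
  non-neighbour, and a flag complex with this property is that of a crosspolytope.
\<close>

subsection \<open>Shellings and Stanley--Reisner rings\<close>

text \<open>In the factor \<open>1 + t\<close>, the summand 1 accounts for the facets through v and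
  the summand t for those avoiding it. For the chosen direction v lies in no restriction set; for
  the opposite one it lies in that of every facet through v. Comparing the two yields both the
  symmetry of h(lk v) and the shift by one degree.

  Flagness is what makes room for the extra form. In the boundary of a simplex all other vertices
  belong to the link of v, no nonzero form on them is supported outside the link, and the inequality
  fails for d at least 2.

  No quotient ring is formed. The argument stays in one degree of the polynomial ring, where the
  graded piece of the ideal is the span of an explicit finite set. A dimension count against the
  monomials takes the place of the theory of Cohen-Macaulay rings.\<close>

type_synonym 'v mpoly = "'v multiset \<Rightarrow>\<^sub>0 real"

definition smul :: "real \<Rightarrow> 'v mpoly \<Rightarrow> 'v mpoly" where
  "smul c p = Poly_Mapping.single 0 c * p"

definition mon :: "'v multiset \<Rightarrow> 'v mpoly" where
  "mon m = Poly_Mapping.single m 1"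

definition linform :: "'v set \<Rightarrow> ('v \<Rightarrow> real) \<Rightarrow> 'v mpoly" where
  "linform V c = (\<Sum>u\<in>V. smul (c u) (mon {#u#}))"

interpretation mp: vector_space smul
  by unfold_locales
    (simp_all add: smul_def algebra_simps single_add mult_single flip: mult.assoc)

lemma smul_mult_left: "smul c p * q = smul c (p * q)"
  by (simp add: smul_def mult.assoc)

lemma smul_mult_right: "p * smul c q = smul c (p * q)"
  by (simp add: smul_def mult.left_commute)

lemma mon_empty [simp]: "mon {#} = 1"
  by (simp add: mon_def flip: zero_multiset_def)

lemma mon_add: "mon (m + n) = mon m * mon n"
  by (simp add: mon_def mult_single)

lemma mon_eq_iff [simp]: "mon m = mon n \<longleftrightarrow> m = n"
  by (metis mon_def lookup_single_eq lookup_single_not_eq zero_neq_one)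

lemma lookup_mon: "Poly_Mapping.lookup (mon n) m = (if n = m then 1 else 0)"
  by (simp add: mon_def lookup_single)

lemma inj_mon: "inj_on mon A"
  by (simp add: inj_on_def)

lemma lookup_smul: "Poly_Mapping.lookup (smul c p) m = c * Poly_Mapping.lookup p m"
  unfolding smul_def mult_map_scale_conv_mult[symmetric] by (simp add: map.rep_eq when_def)

lemma linform_times_mon: "linform V c * mon m = (\<Sum>u\<in>V. smul (c u) (mon (add_mset u m)))"
  unfolding linform_def sum_distrib_right
  by (simp add: smul_mult_left flip: mon_add)

lemma independent_mon: "mp.independent (mon ` A)"
proof -
  have "Poly_Mapping.lookup (\<Sum>v\<in>t. smul (u v) v) m = u (mon m)"
    if "finite t" "t \<subseteq> mon ` A" "mon m \<in> t" for t u m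
  proof -
    have "Poly_Mapping.lookup v m = (if v = mon m then 1 else 0)" if "v \<in> t" for v
      using that \<open>t \<subseteq> mon ` A\<close> by (auto simp: lookup_mon)
    then have "Poly_Mapping.lookup (\<Sum>v\<in>t. smul (u v) v) m
        = (\<Sum>v\<in>t. if v = mon m then u v else 0)"
      unfolding lookup_sum lookup_smul by (intro sum.cong) auto
    then show ?thesis using that by simp
  qed
  then show ?thesis
    unfolding mp.dependent_explicit
    by (smt (verit, best) image_iff lookup_zero subset_iff)
qed

text \<open>
  Reducing a monomial supported on a facet \<open>F\<close> modulo the linear forms replaces one of its
  variables by variables outside \<open>F\<close>, which moves its support to facets later in the
  order \<open>h\<close>; so the restriction monomials \<open>R F\<close> span.
\<close>

lemma shelling_span:
  fixes h :: "'v set \<Rightarrow> real" and c :: "'j \<Rightarrow> 'v \<Rightarrow> real"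
  assumes U: "mp.subspace U" and fin: "finite \<F>" "finite V" "finite J"
    and cover: "\<And>\<sigma>. \<sigma> \<in> K \<Longrightarrow> \<exists>F\<in>\<F>. R F \<subseteq> \<sigma> \<and> \<sigma> \<subseteq> F"
    and order: "\<And>F F'. F \<in> \<F> \<Longrightarrow> F' \<in> \<F> \<Longrightarrow> R F \<subseteq> F' \<Longrightarrow> F \<noteq> F' \<Longrightarrow> h F < h F'"
    and lsop: "\<And>F u. F \<in> \<F> \<Longrightarrow> u \<in> F \<Longrightarrow>
                 \<exists>g. \<forall>u'\<in>F. (\<Sum>j\<in>J. g j * c j u') = (if u' = u then 1 else 0)"
    and nonface: "\<And>m. set_mset m \<subseteq> V \<Longrightarrow> size m = n \<Longrightarrow> set_mset m \<notin> K \<Longrightarrow> mon m \<in> U"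
    and gens: "\<And>F. F \<in> \<F> \<Longrightarrow> finite (R F) \<Longrightarrow> card (R F) = n \<Longrightarrow> mon (mset_set (R F)) \<in> U"
    and mult: "\<And>j m. j \<in> J \<Longrightarrow> set_mset m \<subseteq> V \<Longrightarrow> Suc (size m) = n \<Longrightarrow>
                 linform V (c j) * mon m \<in> U"
    and m: "set_mset m \<subseteq> V" "size m = n"
  shows "mon m \<in> U"
proof -
  have main: "mon m \<in> U"
    if "F \<in> \<F>" "R F \<subseteq> set_mset m" "set_mset m \<subseteq> F" "set_mset m \<subseteq> V" "size m = n" for F m
    using that
  proof (induction "card {F'\<in>\<F>. h F < h F'}" arbitrary: F m rule: less_induct)
    case less
    have finR: "finite (R F)"
      using less.prems(2) finite_subset by blast
    have sub: "mset_set (R F) \<subseteq># m"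
      using less.prems(2) finR
      by (metis finite_set_mset mset_set_set_mset_msubset msubset_mset_set_iff subset_mset.order_trans)
    show ?case
    proof (cases "m = mset_set (R F)")
      case True
      with less.prems finR gens show ?thesis by (metis size_mset_set)
    next
      case False
      with sub obtain b where b: "m = mset_set (R F) + b" "b \<noteq> {#}"
        by (metis add.right_neutral mset_subset_eq_exists_conv)
      then obtain u b' where "b = add_mset u b'"
        by (meson multiset_cases)
      define m' where "m' = mset_set (R F) + b'"
      have mm': "m = add_mset u m'"
        using b \<open>b = add_mset u b'\<close> by (simp add: m'_def)
      have RF: "R F \<subseteq> set_mset m'"
        using finR by (simp add: m'_def)
      have u: "u \<in> F" "u \<in> V" "set_mset m' \<subseteq> V" "set_mset m' \<subseteq> F" "Suc (size m') = n"
        using less.prems mm' by auto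
      \<comment> \<open>This combination of the linear forms restricts to the indicator of
        \<open>u\<close> on \<open>F\<close>; multiplied by \<open>m'\<close> it gives
        \<open>m\<close> plus terms in variables outside \<open>F\<close> only.\<close>
      obtain g where g: "\<And>u'. u' \<in> F \<Longrightarrow> (\<Sum>j\<in>J. g j * c j u') = (if u' = u then 1 else 0)"
        using lsop less.prems(1) u(1) by meson
      define e where "e u' = (\<Sum>j\<in>J. g j * c j u')" for u'
      have "(\<Sum>j\<in>J. smul (g j) (linform V (c j) * mon m'))
          = (\<Sum>u'\<in>V. smul (e u') (mon (add_mset u' m')))"
        unfolding linform_times_mon e_def mp.scale_sum_right mp.scale_sum_left mp.scale_scale
        by (rule sum.swap)
      also have "\<dots> = mon m + (\<Sum>u'\<in>V-{u}. smul (e u') (mon (add_mset u' m')))"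
        using fin(2) u g by (subst sum.remove[of _ u]) (auto simp: e_def mm')
      finally have eq: "mon m = (\<Sum>j\<in>J. smul (g j) (linform V (c j) * mon m'))
          - (\<Sum>u'\<in>V-{u}. smul (e u') (mon (add_mset u' m')))"
        by simp
      have "smul (e u') (mon (add_mset u' m')) \<in> U" if "u' \<in> V - {u}" for u'
      proof (cases "u' \<in> F")
        case True
        then have "e u' = 0" using g that by (simp add: e_def)
        then show ?thesis using U by (simp add: mp.subspace_0)
      next
        case notF: False
        have "mon (add_mset u' m') \<in> U"
        proof (cases "set_mset (add_mset u' m') \<in> K")
          case True
          then obtain F' where F': "F' \<in> \<F>" "R F' \<subseteq> set_mset (add_mset u' m')"
              "set_mset (add_mset u' m') \<subseteq> F'"
            using cover by meson
          \<comment> \<open>\<open>R F\<close> survives in the support of \<open>m'\<close> and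
            hence lies in \<open>F'\<close>, while \<open>u'\<close> witnesses
            \<open>F \<noteq> F'\<close>; so \<open>F'\<close> comes strictly later.\<close>
          then have lt: "h F < h F'"
            using order[of F F'] less.prems(1) RF notF by auto
          then have "card {G\<in>\<F>. h F' < h G} < card {G\<in>\<F>. h F < h G}"
            using fin(1) F'(1) by (intro psubset_card_mono) auto
          then show ?thesis
            using less.hyps F' u that by auto
        qed (use nonface u that in auto)
        then show ?thesis using U by (simp add: mp.subspace_scale)
      qed
      moreover have "smul (g j) (linform V (c j) * mon m') \<in> U" if "j \<in> J" for j
        using mult that u U by (simp add: mp.subspace_scale)
      ultimately show ?thesis
        unfolding eq using U by (intro mp.subspace_diff mp.subspace_sum)
    qed
  qed
  show ?thesis
  proof (cases "set_mset m \<in> K")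
    case True
    then show ?thesis using cover[of "set_mset m"] main m by blast
  qed (use nonface m in auto)
qed


text \<open>
  For the first complex, the products \<open>e (F, \<alpha>)\<close> of restriction monomials with monomials in the linear
  forms are as many as the monomials of the same degree, so they form a basis and exactly
  \<open>card {F\<in>\<F>1. card (R1 F) = n}\<close> dimensions survive modulo the linear forms. The second
  shelling provides a spanning set of that quotient, because the extra form \<open>l\<close> vanishes in
  the face ring of the first complex.
\<close>

lemma shelling_compare:
  fixes h1 h2 :: "'v set \<Rightarrow> real" and c :: "'j \<Rightarrow> 'v \<Rightarrow> real" and l :: "'v \<Rightarrow> real"
  assumes fin: "finite \<F>1" "finite \<F>2" "finite V" "finite J"
    and down: "\<And>\<sigma> \<tau>. \<tau> \<in> K1 \<Longrightarrow> \<sigma> \<subseteq> \<tau> \<Longrightarrow> \<sigma> \<in> K1"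
    and facets1: "\<And>F. F \<in> \<F>1 \<Longrightarrow> F \<in> K1 \<and> F \<subseteq> V \<and> card F = card J \<and> R1 F \<subseteq> F"
    and cover1: "\<And>\<sigma>. \<sigma> \<in> K1 \<Longrightarrow> \<exists>F\<in>\<F>1. R1 F \<subseteq> \<sigma> \<and> \<sigma> \<subseteq> F"
    and order1: "\<And>F F'. F \<in> \<F>1 \<Longrightarrow> F' \<in> \<F>1 \<Longrightarrow> R1 F \<subseteq> F' \<Longrightarrow> F \<noteq> F' \<Longrightarrow> h1 F < h1 F'"
    and lsop1: "\<And>F u. F \<in> \<F>1 \<Longrightarrow> u \<in> F \<Longrightarrow>
                 \<exists>g. \<forall>u'\<in>F. (\<Sum>j\<in>J. g j * c j u') = (if u' = u then 1 else 0)"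
    and sub: "K1 \<subseteq> K2"
    and cover2: "\<And>\<sigma>. \<sigma> \<in> K2 \<Longrightarrow> \<exists>F\<in>\<F>2. R2 F \<subseteq> \<sigma> \<and> \<sigma> \<subseteq> F"
    and order2: "\<And>F F'. F \<in> \<F>2 \<Longrightarrow> F' \<in> \<F>2 \<Longrightarrow> R2 F \<subseteq> F' \<Longrightarrow> F \<noteq> F' \<Longrightarrow> h2 F < h2 F'"
    and lsop2: "\<And>F u. F \<in> \<F>2 \<Longrightarrow> u \<in> F \<Longrightarrow>
                 \<exists>g s. \<forall>u'\<in>F. (\<Sum>j\<in>J. g j * c j u') + s * l u' = (if u' = u then 1 else 0)"
    and l: "\<And>u. u \<in> V \<Longrightarrow> {u} \<in> K1 \<Longrightarrow> l u = 0"
  shows "card {F\<in>\<F>1. card (R1 F) = n} \<le> card {F\<in>\<F>2. card (R2 F) = n}"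
proof -
  \<comment> \<open>\<open>N k\<close> holds the non-face monomials, and \<open>S' k\<close> spans
    the degree \<open>k\<close> part of the ideal generated by such monomials and the linear forms.
    \<open>S k\<close> adds the bare restriction monomials, the candidates for a basis of the
    quotient.\<close>
  define I where "I k = {(F, \<alpha>). F \<in> \<F>1 \<and> set_mset \<alpha> \<subseteq> J \<and> card (R1 F) + size \<alpha> = k}" for k
  define I' where "I' k = {x \<in> I k. snd x \<noteq> {#}}" for k
  define e where "e = (\<lambda>(F, \<alpha>). mon (mset_set (R1 F)) * (\<Prod>j\<in>#\<alpha>. linform V (c j)))"
  define M where "M k = {m \<in> multisets_of_size V k. set_mset m \<in> K1}" for k
  define N where "N k = {m \<in> multisets_of_size V k. set_mset m \<notin> K1}" for k
  define S where "S k = e ` I k \<union> mon ` N k" for k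
  define S' where "S' k = e ` I' k \<union> mon ` N k" for k
  have finV: "finite F" if "F \<subseteq> V" for F
    using that fin(3) finite_subset by blast
  have finM: "finite (M k)" "finite (N k)" for k
    using finite_multisets_of_size[OF fin(3)] by (auto simp: M_def N_def)
  have finR: "finite (R1 F)" if "F \<in> \<F>1" for F
    using facets1[OF that] finV by blast
  have finI: "finite (I k)" for k
  proof (rule finite_subset)
    show "I k \<subseteq> \<F>1 \<times> (\<Union>i\<le>k. multisets_of_size J i)"
      by (auto simp: I_def multisets_of_size_def)
    show "finite (\<F>1 \<times> (\<Union>i\<le>k. multisets_of_size J i))"
      using fin finite_multisets_of_size by blast
  qed

  have mult_N: "linform V (c' :: 'v \<Rightarrow> real) * mon m \<in> mp.span (mon ` N (Suc k))" if "m \<in> N k" for c' m k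
    unfolding linform_times_mon
  proof (intro mp.span_sum mp.span_scale mp.span_base imageI)
    fix u assume "u \<in> V"
    moreover have "set_mset (add_mset u m) \<notin> K1"
      using that down[of "set_mset (add_mset u m)" "set_mset m"] by (auto simp: N_def)
    ultimately show "add_mset u m \<in> N (Suc k)"
      using that by (auto simp: N_def multisets_of_size_def)
  qed
  \<comment> \<open>Multiplication by a linear form lengthens \<open>\<alpha>\<close>, which is why
    the product lands in \<open>S'\<close> and not merely in \<open>S\<close>.\<close>
  have mult_S: "linform V (c j) * x \<in> mp.span (S' (Suc k))" if "j \<in> J" "x \<in> mp.span (S k)" for j x k
    using that(2)
  proof (induction rule: mp.span_induct)
    case base
    show ?case
      unfolding mp.subspace_def
      by (auto simp: distrib_left smul_mult_right mp.span_zero mp.span_add mp.span_scale)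
  next
    case (step x)
    then consider y where "y \<in> I k" "x = e y" | m where "m \<in> N k" "x = mon m"
      by (auto simp: S_def)
    then show ?case
    proof cases
      case 1
      obtain F \<alpha> where y: "y = (F, \<alpha>)" by fastforce
      have "linform V (c j) * x = e (F, add_mset j \<alpha>)"
        by (simp add: 1 y e_def mult.left_commute)
      moreover have "(F, add_mset j \<alpha>) \<in> I' (Suc k)"
        using 1 y that by (auto simp: I_def I'_def)
      ultimately show ?thesis
        by (auto simp: S'_def intro!: mp.span_base)
    next
      case 2
      then show ?thesis
        using mult_N mp.span_mono[of "mon ` N (Suc k)" "S' (Suc k)"] by (auto simp: S'_def)
    qed
  qed
  have S'_S: "mp.span (S' k) \<subseteq> mp.span (S k)" for k
    by (intro mp.span_mono) (auto simp: S_def S'_def I'_def)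
  have span_S: "mon m \<in> mp.span (S k)" if "set_mset m \<subseteq> V" "size m = k" for m k
    using that
  proof (induction k arbitrary: m rule: less_induct)
    case (less k)
    show ?case
    proof (rule shelling_span[where U = "mp.span (S k)", OF _ fin(1,3,4) cover1 order1 lsop1])
      show "mon m \<in> mp.span (S k)" if "set_mset m \<subseteq> V" "size m = k" "set_mset m \<notin> K1" for m
        using that by (intro mp.span_base) (auto simp: S_def N_def multisets_of_size_def)
      show "mon (mset_set (R1 F)) \<in> mp.span (S k)" if "F \<in> \<F>1" "card (R1 F) = k" for F
      proof -
        have "(F, {#}) \<in> I k" "e (F, {#}) = mon (mset_set (R1 F))"
          using that by (auto simp: I_def e_def)
        then show ?thesis by (metis S_def UnI1 imageI mp.span_base)
      qed
      show "linform V (c j) * mon m \<in> mp.span (S k)"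
        if "j \<in> J" "set_mset m \<subseteq> V" "Suc (size m) = k" for j m
        using mult_S less.IH[of "size m" m] that S'_S by blast
    qed (use less.prems mp.subspace_span in auto)
  qed

  \<comment> \<open>Replacing the forms in \<open>\<alpha>\<close> by variables of \<open>F\<close>,
    through a bijection of \<open>J\<close> with \<open>F\<close>, turns pairs into monomials
    supported on faces. The intervals from \<open>R1 F\<close> to \<open>F\<close> are disjoint, so
    the support determines \<open>F\<close>.\<close>
  have card_I: "card (I k) \<le> card (M k)" for k
  proof -
    have "\<exists>g. bij_betw g J F" if "F \<in> \<F>1" for F
      using facets1[OF that] fin(4) finV by (metis finite_same_card_bij)
    then obtain g where g: "\<And>F. F \<in> \<F>1 \<Longrightarrow> bij_betw (g F) J F"
      by metis
    define \<phi> where "\<phi> = (\<lambda>(F, \<alpha>). mset_set (R1 F) + image_mset (g F) \<alpha>)"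
    have set_\<phi>: "R1 F \<subseteq> set_mset (\<phi> (F, \<alpha>)) \<and> set_mset (\<phi> (F, \<alpha>)) \<subseteq> F"
      if "(F, \<alpha>) \<in> I k" for F \<alpha>
      using that g[of F] facets1[of F] finR[of F] by (auto simp: \<phi>_def I_def bij_betw_def)
    have "\<phi> ` I k \<subseteq> M k"
    proof safe
      fix F \<alpha> assume *: "(F, \<alpha>) \<in> I k"
      then have F: "F \<in> \<F>1" by (simp add: I_def)
      have "size (\<phi> (F, \<alpha>)) = k"
        using * by (simp add: \<phi>_def I_def)
      then show "\<phi> (F, \<alpha>) \<in> M k"
        using set_\<phi>[OF *] facets1[OF F] down by (auto simp: M_def multisets_of_size_def)
    qed
    moreover have "inj_on \<phi> (I k)"
    proof (rule inj_onI, clarify)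
      fix F \<alpha> F' \<alpha>' assume *: "(F, \<alpha>) \<in> I k" "(F', \<alpha>') \<in> I k" and eq: "\<phi> (F, \<alpha>) = \<phi> (F', \<alpha>')"
      then have F: "F \<in> \<F>1" "F' \<in> \<F>1" "set_mset \<alpha> \<subseteq> J" "set_mset \<alpha>' \<subseteq> J"
        by (auto simp: I_def)
      have "R1 F \<subseteq> F'" "R1 F' \<subseteq> F"
        using set_\<phi>[OF *(1)] set_\<phi>[OF *(2)] eq by auto
      then have "F = F'"
        using order1[OF F(1,2)] order1[OF F(2,1)] by force
      moreover have "image_mset (g F) \<alpha> = image_mset (g F) \<alpha>'"
        using eq \<open>F = F'\<close> by (simp add: \<phi>_def)
      moreover have "inj_on (g F) (set_mset \<alpha> \<union> set_mset \<alpha>')"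
        using g[OF F(1)] F(3,4) by (meson bij_betw_imp_inj_on inj_on_subset Un_least)
      ultimately show "F = F' \<and> \<alpha> = \<alpha>'"
        using image_mset_eq_image_mset_plusD[of "g F" \<alpha> \<alpha>' "{#}"] by auto
    qed
    ultimately show ?thesis
      using finM card_inj_on_le by blast
  qed

  have finS: "finite (S k)" for k
    using finI finM by (simp add: S_def)
  obtain B where B: "B \<subseteq> S n" "mp.independent B" "S n \<subseteq> mp.span B"
    using mp.maximal_independent_subset by blast
  \<comment> \<open>The monomials of degree \<open>n\<close> are independent and lie in the span of
    \<open>S n\<close>, which has at most \<open>card (I n) + card (N n)\<close> elements. With
    \<open>card_I\<close> the chain of inequalities closes up, so \<open>S n\<close> is independent
    and its listed products are distinct.\<close>
  have "card (M n) + card (N n) = card (mon ` (M n \<union> N n))"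
    using finM by (subst card_image[OF inj_mon], subst card_Un_disjoint) (auto simp: M_def N_def)
  also have "\<dots> \<le> card B"
  proof -
    have "mon ` (M n \<union> N n) \<subseteq> mp.span (S n)"
      using span_S by (auto simp: M_def N_def multisets_of_size_def)
    also have "\<dots> \<subseteq> mp.span B"
      using B(3) by (simp add: mp.span_minimal mp.subspace_span)
    finally show ?thesis
      using mp.independent_span_bound[OF finite_subset[OF B(1) finS] independent_mon] by blast
  qed
  finally have *: "card (I n) + card (N n) \<le> card B"
    using card_I[of n] by linarith
  have "card B \<le> card (S n)"
    using B(1) finS by (simp add: card_mono)
  moreover have "card (S n) \<le> card (e ` I n) + card (mon ` N n)"
    unfolding S_def by (rule card_Un_le)
  moreover have "card (mon ` N n) \<le> card (N n)" "card (e ` I n) \<le> card (I n)"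
    using finI finM by (auto intro: card_image_le)
  ultimately have cards: "card B = card (S n)" "card (S n) = card (I n) + card (N n)"
    using * by linarith+
  then have indep: "mp.independent (S n)"
    using B(1,2) finS by (metis card_subset_eq)

  define X where "X = {F\<in>\<F>1. card (R1 F) = n}"
  define Y where "Y = (\<lambda>F. mon (mset_set (R2 F))) ` {F\<in>\<F>2. card (R2 F) = n}"
  have finS': "finite (S' n)"
    using finI finM by (auto simp: S'_def I'_def)
  have cardI': "card (I n) = card X + card (I' n)"
  proof -
    have "I n = (\<lambda>F. (F, {#})) ` X \<union> I' n"
      by (auto simp: I_def I'_def X_def)
    moreover have "card ((\<lambda>F. (F, {#})) ` X) = card X"
      by (intro card_image) (auto simp: inj_on_def)
    moreover have "(\<lambda>F. (F, {#})) ` X \<inter> I' n = {}"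
      by (auto simp: I'_def)
    ultimately show ?thesis
      using finI[of n] card_Un_disjoint by (metis finite_Un)
  qed
  \<comment> \<open>Modulo \<open>S' n\<close> the restriction monomials of the second shelling
    suffice. The index \<open>None\<close> adjoins the extra form \<open>l\<close> to the family
    \<open>c\<close>.\<close>
  have "mon m \<in> mp.span (Y \<union> S' n)" if "set_mset m \<subseteq> V" "size m = n" for m
  proof (rule shelling_span[where U = "mp.span (Y \<union> S' n)" and K = K2 and \<F> = \<F>2 and R = R2
        and h = h2 and J = "insert None (Some ` J)" and c = "case_option l c"])
    fix F u assume "F \<in> \<F>2" "u \<in> F"
    then obtain g s where g: "\<forall>u'\<in>F. (\<Sum>j\<in>J. g j * c j u') + s * l u' = (if u' = u then 1 else 0)"
      using lsop2 by meson
    have "(\<Sum>j\<in>insert None (Some ` J). case_option s g j * case_option l c j u')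
        = s * l u' + (\<Sum>j\<in>J. g j * c j u')" for u'
      using fin(4) by (subst sum.insert) (auto simp: sum.reindex)
    then show "\<exists>g. \<forall>u'\<in>F. (\<Sum>j\<in>insert None (Some ` J). g j * case_option l c j u')
        = (if u' = u then 1 else 0)"
      using g by (intro exI[of _ "case_option s g"]) (simp add: add.commute)
  next
    fix m assume "set_mset m \<subseteq> V" "size m = n" "set_mset m \<notin> K2"
    then show "mon m \<in> mp.span (Y \<union> S' n)"
      using sub by (intro mp.span_base) (auto simp: S'_def N_def multisets_of_size_def)
  next
    fix F assume "F \<in> \<F>2" "card (R2 F) = n"
    then show "mon (mset_set (R2 F)) \<in> mp.span (Y \<union> S' n)"
      by (intro mp.span_base) (auto simp: Y_def)
  next
    fix j m assume j: "j \<in> insert None (Some ` J)" and m: "set_mset m \<subseteq> V" "Suc (size m) = n"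
    have "linform V (case_option l c j) * mon m \<in> mp.span (S' n)"
    proof (cases j)
      case None
      show ?thesis
        unfolding None option.case linform_times_mon
      proof (rule mp.span_sum)
        fix u assume "u \<in> V"
        show "smul (l u) (mon (add_mset u m)) \<in> mp.span (S' n)"
        proof (cases "l u = 0")
          case False
          \<comment> \<open>Every variable occurring in \<open>l\<close> is a non-vertex of
            \<open>K1\<close>, so a multiple of \<open>l\<close> involves only non-face
            monomials.\<close>
          then have "set_mset (add_mset u m) \<notin> K1"
            using l[OF \<open>u \<in> V\<close>] down[of "set_mset (add_mset u m)" "{u}"] by auto
          then have "add_mset u m \<in> N n"
            using m \<open>u \<in> V\<close> by (auto simp: N_def multisets_of_size_def)
          then have "mon (add_mset u m) \<in> S' n"
            by (simp add: S'_def)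
          then show ?thesis
            by (intro mp.span_scale mp.span_base)
        qed (simp add: mp.span_zero)
      qed
    next
      case (Some i)
      then show ?thesis
        using j m mult_S[of i "mon m" "size m"] span_S[of m "size m"] by auto
    qed
    then show "linform V (case_option l c j) * mon m \<in> mp.span (Y \<union> S' n)"
      using mp.span_mono[of "S' n" "Y \<union> S' n"] by blast
  qed (use that fin cover2 order2 mp.subspace_span in auto)
  note span_Y = this
  have "e x \<in> mp.span (Y \<union> S' n)" if "x \<in> I n" for x
  proof (cases "x \<in> I' n")
    case True
    then show ?thesis by (intro mp.span_base) (auto simp: S'_def)
  next
    case False
    with that obtain F where F: "x = (F, {#})" "F \<in> \<F>1" "card (R1 F) = n"
      by (auto simp: I_def I'_def)
    then have "set_mset (mset_set (R1 F)) \<subseteq> V"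
      using facets1[of F] finR by auto
    then show ?thesis
      using F span_Y
      by (simp add: e_def)
  qed
  moreover have "mon ` N n \<subseteq> mp.span (Y \<union> S' n)"
    by (auto simp: S'_def intro: mp.span_base)
  ultimately have "S n \<subseteq> mp.span (Y \<union> S' n)"
    by (auto simp: S_def)
  moreover have "finite Y"
    using fin by (simp add: Y_def)
  ultimately have "card (S n) \<le> card (Y \<union> S' n)"
    using mp.independent_span_bound[OF _ indep] finS' by blast
  \<comment> \<open>\<open>S n\<close> is independent and spanned by \<open>Y \<union> S' n\<close>.
    Both counts contain the contribution of \<open>I' n\<close> and \<open>N n\<close>; cancelling
    it leaves \<open>X\<close> against \<open>Y\<close>.\<close>
  also have "\<dots> \<le> card Y + card (S' n)"
    by (rule card_Un_le)
  also have "card (S' n) \<le> card (I' n) + card (N n)"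
    unfolding S'_def using finI finM
    by (intro order.trans[OF card_Un_le] add_mono card_image_le) (auto simp: I'_def)
  finally have "card X \<le> card Y"
    using cards cardI' by linarith
  also have "card Y \<le> card {F\<in>\<F>2. card (R2 F) = n}"
    unfolding Y_def using fin by (intro card_image_le) auto
  finally show ?thesis by (simp add: X_def)
qed

subsection \<open>The \<open>h\<close>-polynomial of a partitioned complex\<close>

lemma h_poly_eq_sum_faces:
  assumes "finite K" "\<And>\<sigma>. \<sigma> \<in> K \<Longrightarrow> card \<sigma> \<le> k"
  shows "h_poly k K = (\<Sum>\<sigma>\<in>K. [:0, 1:] ^ card \<sigma> * [:1, -1:] ^ (k - card \<sigma>))"
proof -
  have "(\<Sum>\<sigma>\<in>K. [:0, 1:] ^ card \<sigma> * [:1, -1:] ^ (k - card \<sigma>) :: int poly)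
      = (\<Sum>i\<le>k. \<Sum>\<sigma>\<in>{\<sigma>\<in>K. card \<sigma> = i}. [:0, 1:] ^ card \<sigma> * [:1, -1:] ^ (k - card \<sigma>))"
    using assms by (subst sum.group) auto
  also have "\<dots> = h_poly k K"
    unfolding h_poly_def num_faces_def by (intro sum.cong) (auto simp: mult.assoc)
  finally show ?thesis ..
qed

lemma sum_binomial_interval:
  fixes x y :: "'c::comm_ring_1"
  assumes "finite F" "R \<subseteq> F"
  shows "(\<Sum>\<sigma> | R \<subseteq> \<sigma> \<and> \<sigma> \<subseteq> F. x ^ card \<sigma> * y ^ (card F - card \<sigma>)) = x ^ card R * (x + y) ^ (card F - card R)"
proof -
  have fin: "finite R" "finite (F - R)" using assms finite_subset by auto
  have "(\<Sum>\<sigma> | R \<subseteq> \<sigma> \<and> \<sigma> \<subseteq> F. x ^ card \<sigma> * y ^ (card F - card \<sigma>))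
      = (\<Sum>\<tau>\<in>Pow (F - R). x ^ card R * ((\<Prod>u\<in>\<tau>. x) * (\<Prod>u\<in>(F - R) - \<tau>. y)))"
  proof (rule sum.reindex_bij_witness[where i = "\<lambda>\<tau>. R \<union> \<tau>" and j = "\<lambda>\<sigma>. \<sigma> - R"])
    fix \<sigma> assume \<sigma>: "\<sigma> \<in> {\<sigma>. R \<subseteq> \<sigma> \<and> \<sigma> \<subseteq> F}"
    then have "finite \<sigma>" using assms finite_subset by blast
    moreover have "F - R - (\<sigma> - R) = F - \<sigma>" using \<sigma> by auto
    moreover have "card \<sigma> = card R + card (\<sigma> - R)"
      using \<sigma> fin \<open>finite \<sigma>\<close> by (simp add: card_Diff_subset card_mono)
    ultimately show "x ^ card R * ((\<Prod>u\<in>\<sigma> - R. x) * (\<Prod>u\<in>F - R - (\<sigma> - R). y)) = x ^ card \<sigma> * y ^ (card F - card \<sigma>)"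
      using \<sigma> by (simp add: card_Diff_subset power_add mult.assoc)
  qed (use assms in auto)
  also have "\<dots> = x ^ card R * (x + y) ^ (card F - card R)"
    using prod_add[OF fin(2), of "\<lambda>_. x" "\<lambda>_. y"] fin assms
    by (simp add: card_Diff_subset flip: sum_distrib_left)
  finally show ?thesis .
qed

text \<open>Since t + (1 - t) = 1, the interval from \<open>R F\<close> to \<open>F\<close>
  contributes exactly t to the power \<open>card (R F)\<close>. The intervals are disjoint: a common
  face of two of them would give \<open>R F \<subseteq> F'\<close> and
  \<open>R F' \<subseteq> F\<close>, hence \<open>h F < h F' < h F\<close>.\<close>

lemma coeff_h_poly_partition:
  assumes "finite \<F>"
    and facets: "\<And>F. F \<in> \<F> \<Longrightarrow> finite F \<and> card F = k \<and> R F \<subseteq> F"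
    and K: "\<And>\<sigma>. \<sigma> \<in> K \<longleftrightarrow> (\<exists>F\<in>\<F>. R F \<subseteq> \<sigma> \<and> \<sigma> \<subseteq> F)"
    and order: "\<And>F F'. F \<in> \<F> \<Longrightarrow> F' \<in> \<F> \<Longrightarrow> R F \<subseteq> F' \<Longrightarrow> F \<noteq> F' \<Longrightarrow> (h F :: real) < h F'"
  shows "coeff (h_poly k K) i = int (card {F\<in>\<F>. card (R F) = i})"
proof -
  have K_eq: "K = (\<Union>F\<in>\<F>. {\<sigma>. R F \<subseteq> \<sigma> \<and> \<sigma> \<subseteq> F})"
    using K by auto
  have fin: "finite {\<sigma>. R F \<subseteq> \<sigma> \<and> \<sigma> \<subseteq> F}" if "F \<in> \<F>" for F
    using facets[OF that] by (auto intro: finite_subset[of _ "Pow F"])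
  then have "finite K" using assms(1) K_eq by auto
  moreover have "card \<sigma> \<le> k" if "\<sigma> \<in> K" for \<sigma>
    using that K facets card_mono by metis
  ultimately have "h_poly k K = (\<Sum>\<sigma>\<in>K. [:0, 1:] ^ card \<sigma> * [:1, -1:] ^ (k - card \<sigma>))"
    by (rule h_poly_eq_sum_faces)
  also have "\<dots> = (\<Sum>F\<in>\<F>. \<Sum>\<sigma> | R F \<subseteq> \<sigma> \<and> \<sigma> \<subseteq> F. [:0, 1:] ^ card \<sigma> * [:1, -1:] ^ (k - card \<sigma>))"
    unfolding K_eq
  proof (rule sum.UNION_disjoint)
    show "\<forall>F\<in>\<F>. \<forall>F'\<in>\<F>. F \<noteq> F' \<longrightarrow>
        {\<sigma>. R F \<subseteq> \<sigma> \<and> \<sigma> \<subseteq> F} \<inter> {\<sigma>. R F' \<subseteq> \<sigma> \<and> \<sigma> \<subseteq> F'} = {}"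
      using order by (smt (verit, best) disjoint_iff mem_Collect_eq order_trans)
  qed (use assms(1) fin in auto)
  also have "\<dots> = (\<Sum>F\<in>\<F>. monom 1 (card (R F)))"
  proof (rule sum.cong)
    fix F assume "F \<in> \<F>"
    have "[:0, 1:] + [:1, -1:] = (1 :: int poly)"
      by (simp add: one_pCons)
    with \<open>F \<in> \<F>\<close> show "(\<Sum>\<sigma> | R F \<subseteq> \<sigma> \<and> \<sigma> \<subseteq> F. [:0, 1:] ^ card \<sigma> * [:1, -1:] ^ (k - card \<sigma>))
        = monom (1::int) (card (R F))"
      using sum_binomial_interval[of F "R F" "[:0, 1::int:]" "[:1, -1:]"] facets[of F]
      by (simp only:) (simp add: monom_altdef)
  qed simp
  finally show ?thesis
    using assms(1) by (simp add: coeff_sum sum.If_cases Int_def)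
qed

subsection \<open>Line shellings of complete simplicial fans\<close>

text \<open>The new vector \<open>z\<close> itself is a direction in which
  \<open>z \<bullet> w\<close> moves, as \<open>z \<noteq> 0\<close>; along it only finitely many
  step lengths make some pairing vanish.\<close>

lemma ex_generic_vector:
  fixes E :: "'e::euclidean_space set"
  assumes "finite Z" "Z \<subseteq> E" "0 \<notin> Z" "subspace E"
  shows "\<exists>w\<in>E. \<forall>z\<in>Z. z \<bullet> w \<noteq> 0"
  using assms
proof (induction Z rule: finite_induct)
  case empty
  then show ?case using subspace_0 by auto
next
  case (insert z Z)
  then obtain w where w: "w \<in> E" "\<forall>z\<in>Z. z \<bullet> w \<noteq> 0" by auto
  have "finite ((\<lambda>z'. - (z' \<bullet> w) / (z' \<bullet> z)) ` insert z Z)"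
    using insert.hyps by simp
  then obtain \<epsilon> where \<epsilon>: "\<epsilon> \<notin> (\<lambda>z'. - (z' \<bullet> w) / (z' \<bullet> z)) ` insert z Z"
    using ex_new_if_finite infinite_UNIV_char_0 by blast
  have "z' \<bullet> (w + \<epsilon> *\<^sub>R z) \<noteq> 0" if "z' \<in> insert z Z" for z'
  proof (cases "z' \<bullet> z = 0")
    case True
    with that w insert.prems show ?thesis by (auto simp: inner_right_distrib)
  next
    case False
    have "\<epsilon> \<noteq> - (z' \<bullet> w) / (z' \<bullet> z)" using \<epsilon> that by blast
    then show ?thesis using False by (auto simp: inner_right_distrib field_simps)
  qed
  moreover have "w + \<epsilon> *\<^sub>R z \<in> E"
    using w insert.prems by (simp add: subspace_add subspace_scale)
  ultimately show ?case by blast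
qed

lemma finite_strictly_bounded:
  fixes B :: "real set"
  assumes "finite B"
  shows "\<exists>N. \<forall>b\<in>B. b < N"
  using bdd_above_finite[OF assms] by (metis bdd_above.E gt_ex order_le_less_trans)

text \<open>
  \<open>\<F>\<close> consists of the vertex sets of the facets, \<open>p\<close> sends a vertex to its position relative to an
  interior point, \<open>y F\<close> is the dual basis of \<open>p ` F\<close>, and \<open>a F \<bullet> x = 1\<close> is the hyperplane spanned by
  the facet.
\<close>

locale simplicial_fan =
  fixes V :: "'v set" and p :: "'v \<Rightarrow> 'e::euclidean_space" and E :: "'e set"
    and \<F> :: "'v set set" and d :: nat
    and a :: "'v set \<Rightarrow> 'e" and y :: "'v set \<Rightarrow> 'v \<Rightarrow> 'e"
  assumes finite_V: "finite V" and V_eq: "V = \<Union>\<F>" and card_facet: "F \<in> \<F> \<Longrightarrow> card F = d"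
    and subspace_E: "subspace E" and p_in_E: "u \<in> V \<Longrightarrow> p u \<in> E"
    and y_in_E: "F \<in> \<F> \<Longrightarrow> u \<in> F \<Longrightarrow> y F u \<in> E"
    and dual: "F \<in> \<F> \<Longrightarrow> u \<in> F \<Longrightarrow> u' \<in> F \<Longrightarrow> y F u \<bullet> p u' = (if u' = u then 1 else 0)"
    and expand: "F \<in> \<F> \<Longrightarrow> x \<in> E \<Longrightarrow> x = (\<Sum>u\<in>F. (y F u \<bullet> x) *\<^sub>R p u)"
    and height_on: "F \<in> \<F> \<Longrightarrow> u \<in> F \<Longrightarrow> a F \<bullet> p u = 1"
    and height_off: "F \<in> \<F> \<Longrightarrow> u \<in> V \<Longrightarrow> u \<notin> F \<Longrightarrow> a F \<bullet> p u < 1"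
    and complete: "x \<in> E \<Longrightarrow> \<exists>F\<in>\<F>. \<exists>c. (\<forall>u\<in>F. 0 \<le> c u) \<and> x = (\<Sum>u\<in>F. c u *\<^sub>R p u)"
begin

definition \<Delta> :: "'v set set" where
  "\<Delta> = {\<sigma>. \<exists>F\<in>\<F>. \<sigma> \<subseteq> F}"

text \<open>
  Ordering the facets by \<open>a F \<bullet> w\<close> is a line shelling of the polytope, and \<open>R w F\<close> is the smallest
  face of \<open>F\<close> contained in no earlier facet.
\<close>

definition R :: "'e \<Rightarrow> 'v set \<Rightarrow> 'v set" where
  "R w F = {u \<in> F. 0 < y F u \<bullet> w}"

definition generic :: "'e \<Rightarrow> bool" where
  "generic w \<longleftrightarrow> w \<in> E \<and> (\<forall>F\<in>\<F>. \<forall>u\<in>F. y F u \<bullet> w \<noteq> 0)"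

lemma facet_subset: "F \<in> \<F> \<Longrightarrow> F \<subseteq> V"
  using V_eq by auto

lemma finite_facet: "F \<in> \<F> \<Longrightarrow> finite F"
  using facet_subset finite_V finite_subset by blast

lemma finite_\<F>: "finite \<F>"
  using facet_subset finite_V by (metis PowI finite_Pow_iff finite_subset subsetI)

lemma height_le: "F \<in> \<F> \<Longrightarrow> u \<in> V \<Longrightarrow> a F \<bullet> p u \<le> 1"
  using height_on height_off by (metis less_eq_real_def order_refl)

lemma face_down: "\<sigma> \<in> \<Delta> \<Longrightarrow> \<tau> \<subseteq> \<sigma> \<Longrightarrow> \<tau> \<in> \<Delta>"
  by (auto simp: \<Delta>_def)

lemma facet_in_\<Delta>: "F \<in> \<F> \<Longrightarrow> F \<in> \<Delta>"
  by (auto simp: \<Delta>_def)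

lemma vertices_\<Delta>: "vertices_of \<Delta> = V"
  by (auto simp: \<Delta>_def vertices_of_def V_eq)

lemma R_subset: "R w F \<subseteq> F"
  by (auto simp: R_def)

lemma R_uminus: "generic w \<Longrightarrow> F \<in> \<F> \<Longrightarrow> R (- w) F = F - R w F"
  unfolding R_def generic_def by (auto simp: less_le)

lemma generic_uminus: "generic w \<Longrightarrow> generic (- w)"
  using subspace_E by (simp add: generic_def subspace_neg)

lemma inner_expand:
  assumes "F \<in> \<F>" "x \<in> E"
  shows "b \<bullet> x = (\<Sum>u\<in>F. (y F u \<bullet> x) * (b \<bullet> p u))"
  using arg_cong[OF expand[OF assms], of "\<lambda>x. b \<bullet> x"] by (simp add: inner_sum_right)

text \<open>Expanding \<open>w\<close> in the basis given by \<open>F\<close>, the difference of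
  heights is a sum over \<open>F - F'\<close> of products of two negative factors: the coordinate of
  \<open>w\<close>, and \<open>a F' \<bullet> p u - 1\<close>. The sum is nonempty because facets
  have equal cardinality.\<close>

lemma R_order:
  assumes w: "generic w" and F: "F \<in> \<F>" "F' \<in> \<F>" "R w F \<subseteq> F'" "F \<noteq> F'"
  shows "a F \<bullet> w < a F' \<bullet> w"
proof -
  have wE: "w \<in> E" using w by (simp add: generic_def)
  have neg: "y F u \<bullet> w < 0" if "u \<in> F - F'" for u
    using that F w unfolding R_def generic_def by fastforce
  have "F - F' \<noteq> {}"
    using F card_facet finite_facet by (metis Diff_eq_empty_iff card_subset_eq)
  then have "0 < (\<Sum>u\<in>F-F'. (y F u \<bullet> w) * (a F' \<bullet> p u - 1))"
  proof (intro sum_pos)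
    fix u assume u: "u \<in> F - F'"
    then have "a F' \<bullet> p u < 1" using F facet_subset height_off by blast
    with neg[OF u] show "0 < (y F u \<bullet> w) * (a F' \<bullet> p u - 1)" by (simp add: mult_neg_neg)
  qed (use F finite_facet in auto)
  also have "\<dots> = (\<Sum>u\<in>F. (y F u \<bullet> w) * (a F' \<bullet> p u - 1))"
    using F finite_facet height_on[of F'] by (intro sum.mono_neutral_left) auto
  also have "\<dots> = a F' \<bullet> w - a F \<bullet> w"
    unfolding inner_expand[OF F(1) wE, of "a F"] inner_expand[OF F(1) wE, of "a F'"]
    using F(1) by (simp add: right_diff_distrib sum_subtractf height_on)
  finally show ?thesis by simp
qed

text \<open>
  A facet containing \<open>\<Sum>\<sigma> - w / N\<close> in its cone, for large \<open>N\<close>, contains \<open>\<sigma>\<close> and has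
  nonpositive \<open>w\<close>-coordinates outside \<open>\<sigma>\<close>.
\<close>

lemma R_cover:
  assumes \<sigma>: "\<sigma> \<in> \<Delta>" and w: "w \<in> E"
  shows "\<exists>F\<in>\<F>. R w F \<subseteq> \<sigma> \<and> \<sigma> \<subseteq> F"
proof -
  obtain G where G: "G \<in> \<F>" "\<sigma> \<subseteq> G"
    using \<sigma> by (auto simp: \<Delta>_def)
  have fin: "finite \<sigma>" using G finite_facet finite_subset by blast
  define q where "q = (\<Sum>u\<in>\<sigma>. p u)"
  have qE: "q \<in> E"
    unfolding q_def using G facet_subset p_in_E subspace_E by (blast intro: subspace_sum)
  have q_G: "a G \<bullet> q = card \<sigma>"
    using G height_on by (simp add: q_def inner_sum_right subset_eq)
  have q_F: "a F \<bullet> q < card \<sigma>" if F: "F \<in> \<F>" "\<not> \<sigma> \<subseteq> F" for F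
  proof -
    obtain u where u: "u \<in> \<sigma>" "u \<notin> F" using F by auto
    have "(\<Sum>u\<in>\<sigma>. a F \<bullet> p u) < (\<Sum>u\<in>\<sigma>. 1)"
    proof (rule sum_strict_mono_ex1)
      show "\<forall>u\<in>\<sigma>. a F \<bullet> p u \<le> 1"
        using F(1) G facet_subset height_le by blast
      show "\<exists>u\<in>\<sigma>. a F \<bullet> p u < 1"
        using u F(1) G facet_subset height_off by blast
    qed (fact fin)
    then show ?thesis by (simp add: q_def inner_sum_right)
  qed
  \<comment> \<open>If a facet \<open>F\<close> not containing \<open>\<sigma>\<close> had
    \<open>N *\<^sub>R q - w\<close> in its cone, comparing its heights under \<open>a G\<close> and
    \<open>a F\<close> would bound \<open>N\<close> by this quotient. For facets containing
    \<open>\<sigma>\<close> the denominator is 0, so the quotient is 0 and merely a harmless extra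
    bound.\<close>
  define B where "B = (\<lambda>F. (a G \<bullet> w - a F \<bullet> w) / (card \<sigma> - a F \<bullet> q)) ` \<F>"
  have "finite B" using finite_\<F> by (simp add: B_def)
  then obtain N where N: "\<And>b. b \<in> B \<Longrightarrow> b < N"
    using finite_strictly_bounded by blast
  have "N *\<^sub>R q - w \<in> E"
    using qE w subspace_E by (simp add: subspace_diff subspace_scale)
  then obtain F c where F: "F \<in> \<F>" and c: "\<And>u. u \<in> F \<Longrightarrow> 0 \<le> c u"
      "N *\<^sub>R q - w = (\<Sum>u\<in>F. c u *\<^sub>R p u)"
    using complete by meson
  have cF: "b \<bullet> (N *\<^sub>R q - w) = (\<Sum>u\<in>F. c u * (b \<bullet> p u))" for b
    unfolding c(2) by (simp add: inner_sum_right)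
  have sub: "\<sigma> \<subseteq> F"
  proof (rule ccontr)
    assume not: "\<not> \<sigma> \<subseteq> F"
    have "a G \<bullet> (N *\<^sub>R q - w) \<le> (\<Sum>u\<in>F. c u * 1)"
      unfolding cF using c(1) G F facet_subset by (intro sum_mono mult_left_mono height_le) auto
    also have "\<dots> = a F \<bullet> (N *\<^sub>R q - w)"
      unfolding cF using F height_on by simp
    finally have "N * (card \<sigma> - a F \<bullet> q) \<le> a G \<bullet> w - a F \<bullet> w"
      by (simp add: inner_diff_right q_G algebra_simps)
    then have "N \<le> (a G \<bullet> w - a F \<bullet> w) / (card \<sigma> - a F \<bullet> q)"
      using q_F[OF F not] by (simp add: pos_le_divide_eq)
    moreover have "(a G \<bullet> w - a F \<bullet> w) / (card \<sigma> - a F \<bullet> q) < N"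
      using N F by (simp add: B_def)
    ultimately show False by simp
  qed
  moreover have "R w F \<subseteq> \<sigma>"
  proof (rule ccontr)
    assume "\<not> R w F \<subseteq> \<sigma>"
    then obtain u where u: "u \<in> F" "u \<notin> \<sigma>" "0 < y F u \<bullet> w" by (auto simp: R_def)
    have "y F u \<bullet> q = (\<Sum>u'\<in>\<sigma>. 0)"
      unfolding q_def inner_sum_right using u F sub dual by (intro sum.cong) auto
    then have "y F u \<bullet> (N *\<^sub>R q - w) < 0"
      using u by (simp add: inner_diff_right)
    moreover have "y F u \<bullet> (N *\<^sub>R q - w) = (\<Sum>u'\<in>F. if u' = u then c u' else 0)"
      unfolding cF using F u dual by (intro sum.cong) auto
    ultimately show False
      using c(1)[OF u(1)] u F finite_facet by simp
  qed
  ultimately show ?thesis using F by auto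
qed

lemma \<Delta>_iff_R:
  assumes "generic w"
  shows "\<sigma> \<in> \<Delta> \<longleftrightarrow> (\<exists>F\<in>\<F>. R w F \<subseteq> \<sigma> \<and> \<sigma> \<subseteq> F)"
  using R_cover assms by (auto simp: \<Delta>_def generic_def)

lemma coeff_h_\<Delta>:
  assumes "generic w"
  shows "coeff (h_poly d \<Delta>) i = int (card {F\<in>\<F>. card (R w F) = i})"
  using finite_\<F> card_facet finite_facet R_subset \<Delta>_iff_R[OF assms] R_order[OF assms]
  by (intro coeff_h_poly_partition[where h = "\<lambda>F. a F \<bullet> w"]) auto

lemma ex_generic_sign:
  assumes v: "v \<in> V"
  obtains w where "generic w" "\<And>F. F \<in> \<F> \<Longrightarrow> v \<in> F \<Longrightarrow> y F v \<bullet> w < 0"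
proof -
  define Z where "Z = (\<Union>F\<in>\<F>. y F ` F)"
  have y0: "y F u \<noteq> 0" if "F \<in> \<F>" "u \<in> F" for F u
    using dual[OF that that(2)] by auto
  obtain w where w: "w \<in> E" "\<And>z. z \<in> Z \<Longrightarrow> z \<bullet> w \<noteq> 0"
    using ex_generic_vector[of Z E] finite_\<F> finite_facet y_in_E subspace_E y0
    by (fastforce simp: Z_def)
  \<comment> \<open>Beyond the first set no pairing with \<open>w - N *\<^sub>R p v\<close> can
    vanish; where \<open>z \<bullet> p v = 0\<close> the entry is 0 and the pairing does not move at
    all. The second set secures the sign, because \<open>y F v \<bullet> p v = 1\<close>.\<close>
  define B where "B = (\<lambda>z. (z \<bullet> w) / (z \<bullet> p v)) ` Z \<union> (\<lambda>z. z \<bullet> w) ` Z"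
  have "finite B" using finite_\<F> finite_facet by (simp add: B_def Z_def)
  then obtain N where N: "\<And>b. b \<in> B \<Longrightarrow> b < N"
    using finite_strictly_bounded by blast
  show ?thesis
  proof
    have "z \<bullet> (w - N *\<^sub>R p v) \<noteq> 0" if "z \<in> Z" for z
    proof (cases "z \<bullet> p v = 0")
      case True
      then show ?thesis using w that by (simp add: inner_diff_right)
    next
      case False
      have "(z \<bullet> w) / (z \<bullet> p v) < N" using N that by (simp add: B_def)
      then show ?thesis using False by (auto simp: inner_diff_right)
    qed
    then show "generic (w - N *\<^sub>R p v)"
      using w p_in_E[OF v] subspace_E
      by (auto simp: generic_def Z_def subspace_diff subspace_scale)
    fix F assume F: "F \<in> \<F>" "v \<in> F"
    then have "y F v \<bullet> w \<in> B" by (auto simp: B_def Z_def)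
    then have "y F v \<bullet> w < N" by (rule N)
    then show "y F v \<bullet> (w - N *\<^sub>R p v) < 0"
      using dual[OF F F(2)] by (simp add: inner_diff_right)
  qed
qed


section \<open>Vertex links and the facets avoiding a vertex\<close>

lemma link_eq: "vertex_link \<Delta> v = {\<sigma>. v \<notin> \<sigma> \<and> insert v \<sigma> \<in> \<Delta>}"
  using face_down by (auto simp: vertex_link_def)

text \<open>The difference of both sides is orthogonal to every \<open>p u\<close> with
  \<open>u \<in> F\<close>; these span \<open>E\<close>, so it is orthogonal to itself.\<close>

lemma dual_expand:
  assumes F: "F \<in> \<F>" and x: "x \<in> E"
  shows "x = (\<Sum>u\<in>F. (x \<bullet> p u) *\<^sub>R y F u)"
proof -
  define z where "z = x - (\<Sum>u\<in>F. (x \<bullet> p u) *\<^sub>R y F u)"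
  have zE: "z \<in> E"
    unfolding z_def using F x y_in_E subspace_E by (intro subspace_diff subspace_sum subspace_scale) auto
  have "z \<bullet> p u = 0" if "u \<in> F" for u
  proof -
    have "(\<Sum>u'\<in>F. (x \<bullet> p u') * (y F u' \<bullet> p u)) = (\<Sum>u'\<in>F. if u' = u then x \<bullet> p u' else 0)"
      using F that dual by (intro sum.cong) auto
    then show ?thesis
      using that F finite_facet by (simp add: z_def inner_diff_left inner_sum_left)
  qed
  then have "z \<bullet> z = 0"
    using inner_expand[OF F zE, of z] by simp
  then show ?thesis by (simp add: z_def)
qed

lemma facet_at:
  assumes "v \<in> V" obtains F where "F \<in> \<F>" "v \<in> F"
  using assms V_eq by auto

text \<open>The directions \<open>w\<close> and \<open>- w\<close> both shell the link, with
  complementary restriction sets in \<open>F - {v}\<close>. The two counts together are the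
  Dehn-Sommerville symmetry of the link; the second is written additively to avoid truncated
  subtraction.\<close>

lemma coeff_h_link:
  assumes w: "generic w" and v: "v \<in> V"
    and sgn: "\<And>F. F \<in> \<F> \<Longrightarrow> v \<in> F \<Longrightarrow> y F v \<bullet> w < 0"
  shows "coeff (h_poly (d - 1) (vertex_link \<Delta> v)) i = int (card {F\<in>\<F>. v \<in> F \<and> card (R w F) = i})"
    and "coeff (h_poly (d - 1) (vertex_link \<Delta> v)) i = int (card {F\<in>\<F>. v \<in> F \<and> card (R w F) + i + 1 = d})"
proof -
  define T where "T = {F\<in>\<F>. v \<in> F}"
  define \<G> where "\<G> = (\<lambda>F. F - {v}) ` T"
  have finG: "finite \<G>" using finite_\<F> by (simp add: \<G>_def T_def)
  have vR: "v \<notin> R w F" if "F \<in> \<F>" for F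
    using sgn[OF that] that by (force simp: R_def)
  have inj: "inj_on (\<lambda>F. F - {v}) T"
    by (rule inj_onI) (auto simp: T_def)
  have G: "insert v G \<in> T" "v \<notin> G" if "G \<in> \<G>" for G
    using that by (auto simp: \<G>_def T_def insert_absorb)
  have GT: "F - {v} \<in> \<G>" "insert v F = F" if "F \<in> T" for F
    using that by (auto simp: \<G>_def T_def)
  have card_G: "finite G \<and> card G = d - 1" if "G \<in> \<G>" for G
  proof -
    have "insert v G \<in> \<F>" using G[OF that] by (simp add: T_def)
    then have "finite (insert v G)" "card (insert v G) = d"
      by (fact finite_facet, fact card_facet)
    then show ?thesis using G(2)[OF that] by auto
  qed
  \<comment> \<open>Both directions at once. All facets in \<open>T\<close> contain
    \<open>v\<close>, so deleting \<open>v\<close> from a restriction set does not change which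
    facets of \<open>T\<close> contain it, and the order on the facets of \<open>\<Delta>\<close>
    restricts to the link.\<close>
  have h: "coeff (h_poly (d - 1) (vertex_link \<Delta> v)) i = int (card {F\<in>\<F>. v \<in> F \<and> card (R w' F - {v}) = i})"
    if w': "w' = w \<or> w' = - w" for w'
  proof -
    have gen: "generic w'" using w w' generic_uminus by auto
    have "coeff (h_poly (d - 1) (vertex_link \<Delta> v)) i
        = int (card {G\<in>\<G>. card (R w' (insert v G) - {v}) = i})"
    proof (rule coeff_h_poly_partition[where h = "\<lambda>G. a (insert v G) \<bullet> w'"])
      show "finite G \<and> card G = d - 1 \<and> R w' (insert v G) - {v} \<subseteq> G" if "G \<in> \<G>" for G
        using card_G[OF that] R_subset by blast
      show "\<sigma> \<in> vertex_link \<Delta> v \<longleftrightarrow> (\<exists>G\<in>\<G>. R w' (insert v G) - {v} \<subseteq> \<sigma> \<and> \<sigma> \<subseteq> G)" for \<sigma>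
      proof
        assume "\<sigma> \<in> vertex_link \<Delta> v"
        then have "v \<notin> \<sigma>" "insert v \<sigma> \<in> \<Delta>" by (auto simp: link_eq)
        then obtain F where "F \<in> \<F>" "R w' F \<subseteq> insert v \<sigma>" "insert v \<sigma> \<subseteq> F"
          using \<Delta>_iff_R[OF gen] by auto
        then show "\<exists>G\<in>\<G>. R w' (insert v G) - {v} \<subseteq> \<sigma> \<and> \<sigma> \<subseteq> G"
          using \<open>v \<notin> \<sigma>\<close> GT[of F] by (intro bexI[of _ "F - {v}"]) (auto simp: T_def)
      next
        assume "\<exists>G\<in>\<G>. R w' (insert v G) - {v} \<subseteq> \<sigma> \<and> \<sigma> \<subseteq> G"
        then obtain G where "G \<in> \<G>" "\<sigma> \<subseteq> G" by blast
        then have "v \<notin> \<sigma>" "insert v G \<in> \<F>" "insert v \<sigma> \<subseteq> insert v G"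
          using G by (auto simp: T_def)
        then have "insert v \<sigma> \<in> \<Delta>"
          using face_down facet_in_\<Delta> by blast
        then show "\<sigma> \<in> vertex_link \<Delta> v"
          using \<open>v \<notin> \<sigma>\<close> by (simp add: link_eq)
      qed
      fix G G' assume *: "G \<in> \<G>" "G' \<in> \<G>" "R w' (insert v G) - {v} \<subseteq> G'" "G \<noteq> G'"
      then show "a (insert v G) \<bullet> w' < a (insert v G') \<bullet> w'"
        using G[of G] G[of G'] by (intro R_order[OF gen]) (auto simp: T_def)
    qed (fact finG)
    also have "{G\<in>\<G>. card (R w' (insert v G) - {v}) = i}
        = (\<lambda>F. F - {v}) ` {F\<in>T. card (R w' F - {v}) = i}"
      using GT(2) unfolding \<G>_def by force
    also have "card \<dots> = card {F\<in>T. card (R w' F - {v}) = i}"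
      by (intro card_image inj_on_subset[OF inj]) auto
    finally show ?thesis by (simp add: T_def conj_assoc)
  qed
  show "coeff (h_poly (d - 1) (vertex_link \<Delta> v)) i = int (card {F\<in>\<F>. v \<in> F \<and> card (R w F) = i})"
    using h[of w] vR by (simp cong: conj_cong)
  have "card (R (- w) F - {v}) = i \<longleftrightarrow> card (R w F) + i + 1 = d" if "F \<in> \<F>" "v \<in> F" for F
  proof -
    have "R (- w) F - {v} = F - insert v (R w F)"
      using R_uminus[OF w that(1)] by auto
    moreover have "card (insert v (R w F)) = Suc (card (R w F))"
      using vR that R_subset finite_facet by (metis card_insert_disjoint finite_subset)
    moreover have "insert v (R w F) \<subseteq> F" using that R_subset by auto
    ultimately have "card (R (- w) F - {v}) = d - Suc (card (R w F))" "Suc (card (R w F)) \<le> d"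
      using finite_facet[OF that(1)] card_facet[OF that(1)]
      by (metis card_Diff_subset finite_subset, metis card_mono)
    then show ?thesis by auto
  qed
  then show "coeff (h_poly (d - 1) (vertex_link \<Delta> v)) i
      = int (card {F\<in>\<F>. v \<in> F \<and> card (R w F) + i + 1 = d})"
    using h[of "- w"] by (simp cong: conj_cong)
qed

text \<open>
  Flagness makes the extra linear form \<open>l\<close> possible: a facet avoiding \<open>v\<close> cannot have all vertices
  carrying \<open>v\<close>-coordinates in the link of \<open>v\<close>, hence \<open>q F \<noteq> 0\<close>.
\<close>

lemma link_compare:
  assumes flag: "flag_complex \<Delta>" and w: "generic w" and v: "v \<in> V"
    and sgn: "\<And>F. F \<in> \<F> \<Longrightarrow> v \<in> F \<Longrightarrow> y F v \<bullet> w < 0"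
  shows "card {F\<in>\<F>. v \<in> F \<and> card (R w F) = n} \<le> card {F\<in>\<F>. v \<notin> F \<and> card (R (- w) F) = n}"
proof -
  define T where "T = {F\<in>\<F>. v \<in> F}"
  define B where "B = {F\<in>\<F>. v \<notin> F}"
  define \<G> where "\<G> = (\<lambda>F. F - {v}) ` T"
  define lk where "lk = vertex_link \<Delta> v"
  have vR: "v \<notin> R w F" if "F \<in> \<F>" for F
    using sgn[OF that] that by (force simp: R_def)
  have inj: "inj_on (\<lambda>F. F - {v}) T"
    by (rule inj_onI) (auto simp: T_def)
  have G: "insert v G \<in> T" "v \<notin> G" if "G \<in> \<G>" for G
    using that by (auto simp: \<G>_def T_def insert_absorb)
  obtain F0 where F0: "F0 \<in> \<F>" "v \<in> F0" using v facet_at by blast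
  \<comment> \<open>The dual basis of one facet through \<open>v\<close>, without the vector
    belonging to \<open>v\<close>, is a basis of the linear functions on \<open>E\<close> that
    vanish at \<open>p v\<close>; this is the content of \<open>c_expand\<close>.\<close>
  define J where "J = F0 - {v}"
  define c where "c j u = y F0 j \<bullet> p u" for j u
  have c_expand: "(\<Sum>j\<in>J. (x \<bullet> p j) * c j u) = x \<bullet> p u" if "x \<in> E" "x \<bullet> p v = 0" for x u
  proof -
    have "x \<bullet> p u = (\<Sum>j\<in>F0. (x \<bullet> p j) *\<^sub>R y F0 j) \<bullet> p u"
      using dual_expand[OF F0(1) that(1)] by simp
    also have "\<dots> = (\<Sum>j\<in>F0. (x \<bullet> p j) * c j u)"
      by (simp add: inner_sum_left c_def)
    also have "\<dots> = (\<Sum>j\<in>J. (x \<bullet> p j) * c j u)"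
      using that F0 finite_facet by (simp add: J_def sum.remove[of F0 v])
    finally show ?thesis ..
  qed

  \<comment> \<open>The part of the expansion of \<open>p v\<close> over \<open>F\<close> carried by
    vertices outside the link. As \<open>l\<close> vanishes on the link, the linear extension of
    \<open>l\<close> from \<open>F\<close> takes the value \<open>q F \<bullet> z\<close> at
    \<open>p v\<close>, and this must not be 0.\<close>
  define q where "q F = (\<Sum>u | u \<in> F \<and> {u} \<notin> lk. (y F u \<bullet> p v) *\<^sub>R p u)" for F
  have "q F \<noteq> 0" if F: "F \<in> B" for F
  proof
    assume q0: "q F = 0"
    have F': "F \<in> \<F>" "v \<notin> F" using F by (auto simp: B_def)
    define \<sigma> where "\<sigma> = {u \<in> F. {u} \<in> lk}"
    \<comment> \<open>All of \<open>\<sigma>\<close> is adjacent to \<open>v\<close>, so flagness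
      puts both into one facet \<open>H\<close>. Its coordinate for \<open>v\<close> is 1 at
      \<open>p v\<close>, yet would be 0 if \<open>p v\<close> were a combination of vertices in
      \<open>\<sigma>\<close>.\<close>
    have "insert v \<sigma> \<in> \<Delta>"
    proof -
      have "clique_of \<Delta> (insert v \<sigma>)"
        unfolding clique_of_def vertices_\<Delta>
      proof (intro conjI ballI impI)
        show "finite (insert v \<sigma>)" "insert v \<sigma> \<subseteq> V"
          using finite_facet F' facet_subset v by (auto simp: \<sigma>_def)
        fix u u' assume "u \<in> insert v \<sigma>" "u' \<in> insert v \<sigma>" "u \<noteq> u'"
        moreover have "{v, u} \<in> \<Delta>" "{u, v} \<in> \<Delta>" if "u \<in> \<sigma>" for u
          using that by (auto simp: \<sigma>_def lk_def link_eq insert_commute)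
        moreover have "{u, u'} \<in> \<Delta>" if "u \<in> \<sigma>" "u' \<in> \<sigma>"
          using that F' by (auto simp: \<sigma>_def \<Delta>_def)
        ultimately show "{u, u'} \<in> \<Delta>" by blast
      qed
      then show ?thesis using flag by (simp add: flag_complex_def)
    qed
    then obtain H where H: "H \<in> \<F>" "v \<in> H" "\<sigma> \<subseteq> H" by (auto simp: \<Delta>_def)
    have "p v = (\<Sum>u\<in>F. (y F u \<bullet> p v) *\<^sub>R p u)"
      using expand[OF F'(1) p_in_E[OF v]] .
    also have "\<dots> = (\<Sum>u\<in>\<sigma>. (y F u \<bullet> p v) *\<^sub>R p u) + (\<Sum>u | u \<in> F \<and> {u} \<notin> lk. (y F u \<bullet> p v) *\<^sub>R p u)"
      unfolding \<sigma>_def using finite_facet[OF F'(1)]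
      by (subst sum.union_disjoint[symmetric]) (auto intro: sum.cong)
    also have "\<dots> = (\<Sum>u\<in>\<sigma>. (y F u \<bullet> p v) *\<^sub>R p u)"
      using q0 by (simp add: q_def)
    finally have "y H v \<bullet> p v = (\<Sum>u\<in>\<sigma>. (y F u \<bullet> p v) * (y H v \<bullet> p u))"
      by (metis (no_types, lifting) inner_scaleR_right inner_sum_right sum.cong)
    also have "\<dots> = 0"
    proof (intro sum.neutral ballI)
      fix u assume "u \<in> \<sigma>"
      then have "u \<in> H" "u \<noteq> v" using H F' by (auto simp: \<sigma>_def)
      then show "(y F u \<bullet> p v) * (y H v \<bullet> p u) = 0"
        using dual[OF H(1,2)] by simp
    qed
    finally show False
      using dual[OF H(1,2,2)] by simp
  qed
  moreover have "q F \<in> E" if "F \<in> B" for F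
    unfolding q_def using that subspace_E p_in_E facet_subset
    by (intro subspace_sum subspace_scale) (auto simp: B_def)
  ultimately have "\<exists>z\<in>E. \<forall>x\<in>q ` B. x \<bullet> z \<noteq> 0"
    using finite_\<F> subspace_E by (intro ex_generic_vector) (auto simp: B_def)
  then obtain z where z: "z \<in> E" "\<And>F. F \<in> B \<Longrightarrow> q F \<bullet> z \<noteq> 0" by auto
  define l where "l u = (if {u} \<in> lk then 0 else p u \<bullet> z)" for u

  have "card {G\<in>\<G>. card (R w (insert v G)) = n} \<le> card {F\<in>B. card (R (- w) F) = n}"
  proof (rule shelling_compare[where V = "V - {v}" and J = J and c = c and l = l and ?K1.0 = lk
        and ?K2.0 = "{\<sigma>\<in>\<Delta>. v \<notin> \<sigma>}" and ?h1.0 = "\<lambda>G. a (insert v G) \<bullet> w" and ?h2.0 = "\<lambda>F. a F \<bullet> - w"])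
    show "finite \<G>" "finite B" "finite (V - {v})" "finite J"
      using finite_\<F> finite_V finite_facet F0 by (auto simp: \<G>_def B_def T_def J_def)
    show "\<sigma> \<in> lk" if "\<tau> \<in> lk" "\<sigma> \<subseteq> \<tau>" for \<sigma> \<tau>
      using that face_down[of "insert v \<tau>" "insert v \<sigma>"] by (auto simp: lk_def link_eq)
    show "G \<in> lk \<and> G \<subseteq> V - {v} \<and> card G = card J \<and> R w (insert v G) \<subseteq> G" if "G \<in> \<G>" for G
    proof -
      have G': "insert v G \<in> \<F>" "v \<notin> G" using G[OF that] by (auto simp: T_def)
      have "card G = d - 1" "card J = d - 1"
        using card_facet[OF G'(1)] finite_facet[OF G'(1)] G' F0 card_facet[OF F0(1)] finite_facet[OF F0(1)]
        by (auto simp: J_def)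
      moreover have "R w (insert v G) \<subseteq> G" using vR[OF G'(1)] R_subset by blast
      ultimately show ?thesis
        using G' facet_subset facet_in_\<Delta> by (auto simp: lk_def link_eq)
    qed
    show "\<exists>G\<in>\<G>. R w (insert v G) \<subseteq> \<sigma> \<and> \<sigma> \<subseteq> G" if "\<sigma> \<in> lk" for \<sigma>
    proof -
      have "v \<notin> \<sigma>" "insert v \<sigma> \<in> \<Delta>" using that by (auto simp: lk_def link_eq)
      then obtain F where F: "F \<in> \<F>" "R w F \<subseteq> insert v \<sigma>" "insert v \<sigma> \<subseteq> F"
        using \<Delta>_iff_R[OF w] by auto
      then have "insert v (F - {v}) = F" "F - {v} \<in> \<G>" by (auto simp: \<G>_def T_def)
      then show ?thesis
        using \<open>v \<notin> \<sigma>\<close> F vR[OF F(1)] by (intro bexI[of _ "F - {v}"]) auto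
    qed
    show "a (insert v G) \<bullet> w < a (insert v G') \<bullet> w"
      if "G \<in> \<G>" "G' \<in> \<G>" "R w (insert v G) \<subseteq> G'" "G \<noteq> G'" for G G'
      using that G[of G] G[of G'] by (intro R_order[OF w]) (auto simp: T_def)
    show "\<exists>g. \<forall>u'\<in>G. (\<Sum>j\<in>J. g j * c j u') = (if u' = u then 1 else 0)"
      if "G \<in> \<G>" "u \<in> G" for G u
    proof -
      have G': "insert v G \<in> \<F>" "v \<notin> G" using G[OF that(1)] by (auto simp: T_def)
      have "y (insert v G) u \<bullet> p v = 0"
        using dual[OF G'(1), of u v] that G' by auto
      then show ?thesis
        using c_expand[OF y_in_E[OF G'(1)], of u] dual[OF G'(1), of u] that
        by (intro exI[of _ "\<lambda>j. y (insert v G) u \<bullet> p j"]) auto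
    qed
    show "lk \<subseteq> {\<sigma>\<in>\<Delta>. v \<notin> \<sigma>}" by (auto simp: lk_def vertex_link_def)
    show "\<exists>F\<in>B. R (- w) F \<subseteq> \<sigma> \<and> \<sigma> \<subseteq> F" if \<sigma>: "\<sigma> \<in> {\<sigma>\<in>\<Delta>. v \<notin> \<sigma>}" for \<sigma>
    proof -
      obtain F where F: "F \<in> \<F>" "R (- w) F \<subseteq> \<sigma>" "\<sigma> \<subseteq> F"
        using \<Delta>_iff_R[OF generic_uminus[OF w], of \<sigma>] \<sigma> by blast
      \<comment> \<open>For \<open>- w\<close> the vertex \<open>v\<close> is in the restriction set
        of every facet through it, so a face without \<open>v\<close> is assigned to a facet
        avoiding \<open>v\<close>.\<close>
      have "v \<notin> F"
        using F \<sigma> vR[OF F(1)] R_uminus[OF w F(1)] by auto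
      with F show ?thesis by (auto simp: B_def)
    qed
    show "a F \<bullet> - w < a F' \<bullet> - w" if "F \<in> B" "F' \<in> B" "R (- w) F \<subseteq> F'" "F \<noteq> F'" for F F'
      using that by (intro R_order generic_uminus[OF w]) (auto simp: B_def)
    show "l u = 0" if "{u} \<in> lk" for u using that by (simp add: l_def)
    fix F u assume FB: "F \<in> B" and u: "u \<in> F"
    then have F: "F \<in> \<F>" by (simp add: B_def)
    define s where "s = q F \<bullet> z"
    have s: "s \<noteq> 0" using z FB by (simp add: s_def)
    \<comment> \<open>As a linear function on \<open>E\<close>, \<open>Z\<close> agrees with
      \<open>l\<close> on the vertices of \<open>F\<close>, and its value at \<open>p v\<close> is
      the nonzero \<open>s\<close>.\<close>
    define Z where "Z = (\<Sum>u\<in>F. l u *\<^sub>R y F u)"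
    have ZE: "Z \<in> E"
      unfolding Z_def using F y_in_E subspace_E by (intro subspace_sum subspace_scale) auto
    have Z_p: "Z \<bullet> p u' = l u'" if "u' \<in> F" for u'
    proof -
      have "Z \<bullet> p u' = (\<Sum>u\<in>F. if u = u' then l u else 0)"
        unfolding Z_def inner_sum_left using F dual that by (intro sum.cong) auto
      then show ?thesis using that F finite_facet by simp
    qed
    have Z_v: "Z \<bullet> p v = s"
    proof -
      have "Z \<bullet> p v = (\<Sum>u\<in>F. if {u} \<in> lk then 0 else (y F u \<bullet> p v) * (p u \<bullet> z))"
        unfolding Z_def inner_sum_left by (intro sum.cong) (auto simp: l_def)
      also have "\<dots> = s"
        using finite_facet[OF F] by (simp add: s_def q_def inner_sum_left sum.If_cases Int_def)
      finally show ?thesis .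
    qed
    \<comment> \<open>Subtracting this multiple of \<open>Z\<close> makes the coordinate function of
      \<open>u\<close> vanish at \<open>p v\<close>, hence a combination of the \<open>c j\<close>;
      adding the same multiple of \<open>l\<close> restores it on \<open>F\<close>.\<close>
    define x where "x = y F u - ((y F u \<bullet> p v) / s) *\<^sub>R Z"
    have "x \<in> E" "x \<bullet> p v = 0"
      unfolding x_def using y_in_E[OF F u] ZE subspace_E s Z_v
      by (auto simp: subspace_diff subspace_scale inner_diff_left)
    then have "(\<Sum>j\<in>J. (x \<bullet> p j) * c j u') + ((y F u \<bullet> p v) / s) * l u' = (if u' = u then 1 else 0)"
      if "u' \<in> F" for u'
      using c_expand[of x u'] Z_p[OF that] dual[OF F u that] by (simp add: x_def inner_diff_left)
    then show "\<exists>g s. \<forall>u'\<in>F. (\<Sum>j\<in>J. g j * c j u') + s * l u' = (if u' = u then 1 else 0)"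
      by (intro exI[of _ "\<lambda>j. x \<bullet> p j"] exI[of _ "(y F u \<bullet> p v) / s"]) auto
  qed
  also have "{G\<in>\<G>. card (R w (insert v G)) = n} = (\<lambda>F. F - {v}) ` {F\<in>T. card (R w F) = n}"
  proof -
    have "insert v (F - {v}) = F" if "F \<in> T" for F
      using that by (auto simp: T_def)
    then show ?thesis unfolding \<G>_def by force
  qed
  also have "card \<dots> = card {F\<in>T. card (R w F) = n}"
    by (intro card_image inj_on_subset[OF inj]) auto
  finally show ?thesis by (simp add: T_def B_def conj_assoc)
qed

text \<open>Facets through \<open>v\<close> contribute coefficient \<open>i\<close> of h(lk v). The
  facets avoiding \<open>v\<close> must dominate coefficient \<open>i - 1\<close>: by symmetry it
  counts facets through \<open>v\<close> with restriction sets of size \<open>d - i\<close>,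
  \<open>link_compare\<close> passes to facets avoiding \<open>v\<close> in the reversed direction,
  and complementation turns the size back into \<open>i\<close>.\<close>

lemma vertex_inequality:
  assumes flag: "flag_complex \<Delta>" and v: "v \<in> V"
  shows "coeff ([:1, 1:] * h_poly (d - 1) (vertex_link \<Delta> v)) i \<le> coeff (h_poly d \<Delta>) i"
proof -
  obtain w where w: "generic w" and sgn: "\<And>F. F \<in> \<F> \<Longrightarrow> v \<in> F \<Longrightarrow> y F v \<bullet> w < 0"
    using ex_generic_sign[OF v] by blast
  let ?h = "h_poly (d - 1) (vertex_link \<Delta> v)"
  have h: "coeff ?h j = int (card {F\<in>\<F>. v \<in> F \<and> card (R w F) = j})"
    "coeff ?h j = int (card {F\<in>\<F>. v \<in> F \<and> card (R w F) + j + 1 = d})" for j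
    using coeff_h_link[OF w v] sgn by blast+
  have cardR: "card (R w F) \<le> d" if "F \<in> \<F>" for F
    using R_subset finite_facet[OF that] card_facet[OF that] card_mono by metis
  have cardR': "card (R (- w) F) = d - card (R w F)" if "F \<in> \<F>" for F
    using R_uminus[OF w that] R_subset finite_facet[OF that] card_facet[OF that]
    by (metis card_Diff_subset finite_subset)
  have "coeff (h_poly d \<Delta>) i = int (card ({F\<in>\<F>. v \<in> F \<and> card (R w F) = i} \<union> {F\<in>\<F>. v \<notin> F \<and> card (R w F) = i}))"
    unfolding coeff_h_\<Delta>[OF w] by (intro arg_cong[where f = "\<lambda>x. int (card x)"]) auto
  also have "\<dots> = coeff ?h i + int (card {F\<in>\<F>. v \<notin> F \<and> card (R w F) = i})"
    using finite_\<F> h(1)[of i] by (subst card_Un_disjoint) auto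
  finally have h_split: "coeff (h_poly d \<Delta>) i = coeff ?h i + int (card {F\<in>\<F>. v \<notin> F \<and> card (R w F) = i})" .
  have "coeff ?h j \<le> int (card {F\<in>\<F>. v \<notin> F \<and> card (R w F) = i})" if i: "i = Suc j" for j
  proof (cases "i \<le> d")
    case True
    have "coeff ?h j = int (card {F\<in>\<F>. v \<in> F \<and> card (R w F) = d - i})"
      unfolding h(2) using i True by (intro arg_cong[where f = "\<lambda>x. int (card x)"]) auto
    also have "\<dots> \<le> int (card {F\<in>\<F>. v \<notin> F \<and> card (R (- w) F) = d - i})"
      using link_compare[OF flag w v sgn] by simp
    also have "{F\<in>\<F>. v \<notin> F \<and> card (R (- w) F) = d - i} = {F\<in>\<F>. v \<notin> F \<and> card (R w F) = i}"
      using cardR cardR' True by fastforce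
    finally show ?thesis .
  next
    case False
    then have "coeff ?h j = 0"
      unfolding h(2) using i by (auto simp: card_eq_0_iff)
    then show ?thesis by simp
  qed
  then show ?thesis
    unfolding h_split by (cases i) (auto simp: coeff_pCons)
qed

end

subsection \<open>The case of equality\<close>

text \<open>The non-edges form a perfect matching. This condition mediates between the numerical
  equality and the isomorphism with a crosspolytope.\<close>

definition unique_opposite :: "'a set set \<Rightarrow> bool" where
  "unique_opposite K \<longleftrightarrow>
     (\<forall>v\<in>vertices_of K. \<exists>!u. u \<in> vertices_of K \<and> u \<noteq> v \<and> {u, v} \<notin> K)"

lemma flag_iff: "flag_complex K \<Longrightarrow> \<sigma> \<in> K \<longleftrightarrow> clique_of K \<sigma>"
  unfolding flag_complex_def by (rule spec)

lemma flag_faceI: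
  assumes "flag_complex K" "finite \<sigma>" "\<sigma> \<subseteq> vertices_of K"
    and "\<And>u v. u \<in> \<sigma> \<Longrightarrow> v \<in> \<sigma> \<Longrightarrow> u \<noteq> v \<Longrightarrow> {u, v} \<in> K"
  shows "\<sigma> \<in> K"
proof -
  have "clique_of K \<sigma>" unfolding clique_of_def using assms(2-4) by blast
  with flag_iff[OF assms(1)] show ?thesis by (rule iffD2)
qed

lemma flag_faceD:
  assumes "flag_complex K" "\<sigma> \<in> K"
  shows "finite \<sigma>" "\<sigma> \<subseteq> vertices_of K" "\<And>u v. u \<in> \<sigma> \<Longrightarrow> v \<in> \<sigma> \<Longrightarrow> u \<noteq> v \<Longrightarrow> {u, v} \<in> K"
proof -
  have "clique_of K \<sigma>" using flag_iff[OF assms(1)] assms(2) by (rule iffD1)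
  then show "finite \<sigma>" "\<sigma> \<subseteq> vertices_of K" "\<And>u v. u \<in> \<sigma> \<Longrightarrow> v \<in> \<sigma> \<Longrightarrow> u \<noteq> v \<Longrightarrow> {u, v} \<in> K"
    unfolding clique_of_def by blast+
qed

lemma flag_down: "flag_complex K \<Longrightarrow> \<sigma> \<in> K \<Longrightarrow> \<tau> \<subseteq> \<sigma> \<Longrightarrow> \<tau> \<in> K"
  by (rule flag_faceI) (use flag_faceD[of K \<sigma>] in \<open>blast intro: finite_subset\<close>)+

section \<open>Low coefficients, and equality at a single vertex\<close>

lemma coeff_one_minus_X_power:
  "coeff ([:1, -1:] ^ k :: int poly) 0 = 1" "coeff ([:1, -1:] ^ k :: int poly) (Suc 0) = - int k"
  by (induction k) (auto simp: coeff_pCons)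

text \<open>For \<open>k = 0\<close> the sum defining \<open>h_poly\<close> stops before the term of
  the vertices; the premise covers this case.\<close>

lemma coeff_h_poly_1:
  assumes "k = 0 \<Longrightarrow> num_faces K 1 = 0"
  shows "coeff (h_poly k K) 1 = int (num_faces K 1) - int k * int (num_faces K 0)"
proof -
  have X: "[:0, 1:] ^ i = (monom 1 i :: int poly)" for i
    by (simp add: monom_altdef)
  have "coeff (h_poly k K) 1
      = (\<Sum>i\<le>k. int (num_faces K i) * (if i = 0 then - int k else if i = 1 then 1 else 0))"
    unfolding h_poly_def coeff_sum X
    by (intro sum.cong)
      (auto simp: of_nat_poly coeff_monom_mult coeff_one_minus_X_power mult.assoc)
  also have "\<dots> = (\<Sum>i\<in>{..k} \<inter> {0, 1}. int (num_faces K i) * (if i = 0 then - int k else if i = 1 then 1 else 0))"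
    by (intro sum.mono_neutral_right) auto
  also have "\<dots> = int (num_faces K 1) - int k * int (num_faces K 0)"
  proof (cases "k = 0")
    case False
    then have "{..k} \<inter> {0, 1} = {0, 1}" by auto
    then show ?thesis by simp
  qed (use assms in simp)
  finally show ?thesis .
qed

lemma num_faces_0:
  assumes "{} \<in> K" "\<And>\<sigma>. \<sigma> \<in> K \<Longrightarrow> finite \<sigma>"
  shows "num_faces K 0 = 1"
proof -
  have "{\<sigma> \<in> K. card \<sigma> = 0} = {{}}" using assms by auto
  then show ?thesis by (simp add: num_faces_def)
qed

lemma num_faces_1: "num_faces K 1 = card (vertices_of K)"
proof -
  have "{\<sigma> \<in> K. card \<sigma> = 1} = (\<lambda>v. {v}) ` vertices_of K"
    by (auto simp: vertices_of_def card_1_singleton_iff)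
  then show ?thesis by (simp add: num_faces_def card_image)
qed

lemma vertices_of_link:
  assumes "flag_complex K"
  shows "vertices_of (vertex_link K v) = {u \<in> vertices_of K. u \<noteq> v \<and> {u, v} \<in> K}"
  by (auto simp: vertices_of_def vertex_link_def insert_commute)

context
  fixes K :: "'a set set" and d :: nat
  assumes flag: "flag_complex K" and finite_K: "finite K" and card_le: "\<And>\<sigma>. \<sigma> \<in> K \<Longrightarrow> card \<sigma> \<le> d"
begin

lemma card_link_le:
  assumes "\<tau> \<in> vertex_link K v"
  shows "Suc (card \<tau>) \<le> d"
proof -
  have "v \<notin> \<tau>" "insert v \<tau> \<in> K" "finite \<tau>"
    using assms flag_faceD(1)[OF flag] by (auto simp: vertex_link_def)
  then show ?thesis using card_le[of "insert v \<tau>"] by simp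
qed

text \<open>In degree 1 the equality reads \<open>card L - (d - 1) + 1 = card V - d\<close>, so
  beyond \<open>v\<close> and its neighbours \<open>L\<close> exactly one vertex is left.\<close>

lemma h_link_eq_imp_unique_opposite:
  assumes v: "v \<in> vertices_of K"
    and eq: "[:1, 1:] * h_poly (d - 1) (vertex_link K v) = h_poly d K"
  shows "\<exists>!u. u \<in> vertices_of K \<and> u \<noteq> v \<and> {u, v} \<notin> K"
proof -
  let ?lk = "vertex_link K v"
  define V where "V = vertices_of K"
  have "{v} \<in> K" using v by (simp add: vertices_of_def)
  then have d: "d \<ge> 1" using card_le[of "{v}"] by simp
  have "{} \<in> K" using flag_down[OF flag \<open>{v} \<in> K\<close>] by simp
  then have "{} \<in> ?lk" using \<open>{v} \<in> K\<close> by (simp add: vertex_link_def)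
  have finV: "finite V"
  proof -
    have "(\<lambda>v. {v}) ` V \<subseteq> K" by (auto simp: V_def vertices_of_def)
    then show ?thesis using finite_K by (metis finite_imageD finite_subset inj_singleton inj_on_subset subset_UNIV)
  qed
  have fin: "finite \<sigma>" if "\<sigma> \<in> K" for \<sigma> using flag_faceD(1)[OF flag that] .
  have f0: "num_faces K 0 = 1" "num_faces ?lk 0 = 1"
    using num_faces_0[OF \<open>{} \<in> K\<close> fin] num_faces_0[OF \<open>{} \<in> ?lk\<close>] fin
    by (auto simp: vertex_link_def)
  define L where "L = {u \<in> V. u \<noteq> v \<and> {u, v} \<in> K}"
  have L: "vertices_of ?lk = L" using vertices_of_link[OF flag] by (simp add: L_def V_def)
  have "coeff (h_poly d K) 1 = int (card V) - int d"
    using d by (subst coeff_h_poly_1) (auto simp: f0 num_faces_1[simplified] V_def)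
  moreover have "coeff (h_poly (d - 1) ?lk) 1 = int (card L) - int (d - 1)"
  proof (subst coeff_h_poly_1)
    \<comment> \<open>For \<open>d = 1\<close> the bound on face sizes leaves the link without
      vertices, so the formula for the linear coefficient still applies.\<close>
    assume "d - 1 = 0"
    have "L = {}"
    proof (rule ccontr)
      assume "L \<noteq> {}"
      then obtain u where "{u} \<in> ?lk" using L by (auto simp: vertices_of_def)
      then show False using card_link_le[of "{u}" v] \<open>d - 1 = 0\<close> by simp
    qed
    then show "num_faces ?lk 1 = 0" using num_faces_1[of ?lk] L by simp
  qed (use f0 num_faces_1[of ?lk] L in simp)
  moreover have "coeff (h_poly (d - 1) ?lk) 0 = 1"
  proof -
    have "coeff (h_poly (d - 1) ?lk) 0 = (\<Sum>i\<le>d - 1. if i = 0 then 1 else 0)"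
      unfolding h_poly_def coeff_sum
      by (intro sum.cong) (auto simp: coeff_mult_0 coeff_0_power of_nat_poly f0)
    then show ?thesis by simp
  qed
  moreover have "coeff (h_poly d K) 1 = coeff (h_poly (d - 1) ?lk) 1 + coeff (h_poly (d - 1) ?lk) 0"
    unfolding eq[symmetric] by simp
  ultimately have "card L + 2 = card V"
    using d by (simp add: of_nat_diff)
  moreover have "card V = card (insert v L) + card (V - insert v L)"
    using finV v by (subst card_Un_disjoint[symmetric]) (auto intro: arg_cong[where f = card] simp: L_def V_def)
  moreover have "card (insert v L) = Suc (card L)"
    using finV by (intro card_insert_disjoint) (auto simp: L_def)
  ultimately have "card (V - insert v L) = 1" by simp
  moreover have "V - insert v L = {u. u \<in> vertices_of K \<and> u \<noteq> v \<and> {u, v} \<notin> K}"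
    by (auto simp: L_def V_def)
  ultimately obtain u where "{u. u \<in> vertices_of K \<and> u \<noteq> v \<and> {u, v} \<notin> K} = {u}"
    by (metis card_1_singletonE)
  then show ?thesis by (metis (mono_tags, lifting) mem_Collect_eq singletonD singletonI)
qed

text \<open>By flagness \<open>K\<close> is the suspension of the link of \<open>v\<close> with
  apexes \<open>v\<close> and its opposite \<open>u\<close>. Each face of the link gives three faces
  of \<open>K\<close>, with weights 1 - t, t and t relative to its own term, in total 1 + t.\<close>

lemma unique_opposite_imp_h_link_eq:
  assumes opp: "unique_opposite K" and v: "v \<in> vertices_of K"
  shows "[:1, 1:] * h_poly (d - 1) (vertex_link K v) = h_poly d K"
proof -
  let ?lk = "vertex_link K v"
  obtain u where u: "u \<in> vertices_of K" "u \<noteq> v" "{u, v} \<notin> K"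
    and u_unique: "\<And>x. x \<in> vertices_of K \<Longrightarrow> x \<noteq> v \<Longrightarrow> x \<noteq> u \<Longrightarrow> {x, v} \<in> K"
    using opp v unfolding unique_opposite_def by metis
  have v_unique: "{x, u} \<in> K" if "x \<in> vertices_of K" "x \<noteq> v" "x \<noteq> u" for x
    using opp u v that unfolding unique_opposite_def by (metis insert_commute)
  have fin: "finite \<sigma>" if "\<sigma> \<in> K" for \<sigma> using flag_faceD(1)[OF flag that] .
  have not_both: "\<not> (u \<in> \<sigma> \<and> v \<in> \<sigma>)" if "\<sigma> \<in> K" for \<sigma>
    using flag_faceD(3)[OF flag that, of u v] u by auto
  have insert_v: "insert v \<tau> \<in> K" if "\<tau> \<in> K" "u \<notin> \<tau>" for \<tau>
  proof (rule flag_faceI[OF flag])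
    note D = flag_faceD[OF flag that(1)]
    show "finite (insert v \<tau>)" "insert v \<tau> \<subseteq> vertices_of K" using D v by auto
    fix x x' assume "x \<in> insert v \<tau>" "x' \<in> insert v \<tau>" "x \<noteq> x'"
    then show "{x, x'} \<in> K" using D that u_unique by (metis insertE insert_commute subsetD)
  qed
  have insert_u: "insert u \<tau> \<in> K" if "\<tau> \<in> K" "v \<notin> \<tau>" for \<tau>
  proof (rule flag_faceI[OF flag])
    note D = flag_faceD[OF flag that(1)]
    show "finite (insert u \<tau>)" "insert u \<tau> \<subseteq> vertices_of K" using D u by auto
    fix x x' assume "x \<in> insert u \<tau>" "x' \<in> insert u \<tau>" "x \<noteq> x'"
    then show "{x, x'} \<in> K" using D that v_unique by (metis insertE insert_commute subsetD)
  qed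
  have lk: "\<tau> \<in> ?lk \<longleftrightarrow> \<tau> \<in> K \<and> v \<notin> \<tau> \<and> u \<notin> \<tau>" for \<tau>
    using insert_v[of \<tau>] not_both[of "insert v \<tau>"] by (auto simp: vertex_link_def)
  have fin_lk: "finite ?lk" using finite_K by (simp add: vertex_link_def)
  have K_eq: "K = ?lk \<union> (insert v ` ?lk \<union> insert u ` ?lk)"
  proof (intro equalityI subsetI)
    fix \<sigma> assume \<sigma>: "\<sigma> \<in> K"
    have minus: "\<sigma> - {x} \<in> K" for x using flag_down[OF flag \<sigma>] by auto
    consider "\<sigma> \<in> ?lk" | "v \<in> \<sigma>" | "u \<in> \<sigma>" using lk \<sigma> by auto
    then show "\<sigma> \<in> ?lk \<union> (insert v ` ?lk \<union> insert u ` ?lk)"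
    proof cases
      case 2
      then have "\<sigma> = insert v (\<sigma> - {v})" "\<sigma> - {v} \<in> ?lk" using lk minus not_both[OF \<sigma>] by auto
      then show ?thesis by blast
    next
      case 3
      then have "\<sigma> = insert u (\<sigma> - {u})" "\<sigma> - {u} \<in> ?lk" using lk minus not_both[OF \<sigma>] by auto
      then show ?thesis by blast
    qed simp
  qed (use lk insert_u in \<open>auto simp: vertex_link_def\<close>)
  have inj: "inj_on (insert x) ?lk" if "x = u \<or> x = v" for x
    using that lk by (intro inj_onI) (metis insert_ident)
  define X Y :: "int poly" where "X = [:0, 1:]" and "Y = [:1, -1:]"
  define g where "g \<sigma> = X ^ card \<sigma> * Y ^ (d - card \<sigma>)" for \<sigma> :: "'a set"
  have g_insert: "g (insert x \<tau>) = X ^ Suc (card \<tau>) * Y ^ (d - 1 - card \<tau>)"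
    if "\<tau> \<in> ?lk" "x = u \<or> x = v" for x \<tau>
  proof -
    have "card (insert x \<tau>) = Suc (card \<tau>)" using that lk fin by auto
    then show ?thesis by (simp add: g_def)
  qed
  have "h_poly d K = (\<Sum>\<sigma>\<in>?lk \<union> (insert v ` ?lk \<union> insert u ` ?lk). g \<sigma>)"
    unfolding g_def X_def Y_def K_eq[symmetric] using finite_K card_le by (rule h_poly_eq_sum_faces)
  also have "\<dots> = (\<Sum>\<sigma>\<in>?lk. g \<sigma>) + ((\<Sum>\<sigma>\<in>?lk. g (insert v \<sigma>)) + (\<Sum>\<sigma>\<in>?lk. g (insert u \<sigma>)))"
  proof -
    have "insert v ` ?lk \<inter> insert u ` ?lk = {}" "?lk \<inter> (insert v ` ?lk \<union> insert u ` ?lk) = {}"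
    proof -
      have "v \<notin> \<tau>" "u \<notin> \<tau>" if "\<tau> \<in> ?lk" for \<tau> using that lk by simp_all
      moreover have "v \<in> \<sigma>" if "\<sigma> \<in> insert v ` ?lk" for \<sigma> using that by blast
      moreover have "u \<in> \<sigma>" "v \<notin> \<sigma>" if "\<sigma> \<in> insert u ` ?lk" for \<sigma>
        using that u(2) \<open>\<And>\<tau>. \<tau> \<in> ?lk \<Longrightarrow> v \<notin> \<tau>\<close> by blast+
      ultimately show "insert v ` ?lk \<inter> insert u ` ?lk = {}"
        "?lk \<inter> (insert v ` ?lk \<union> insert u ` ?lk) = {}" by blast+
    qed
    then show ?thesis
      using fin_lk inj by (simp add: sum.union_disjoint sum.reindex)
  qed
  also have "\<dots> = (\<Sum>\<tau>\<in>?lk. [:1, 1:] * (X ^ card \<tau> * Y ^ (d - 1 - card \<tau>)))"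
    unfolding sum.distrib[symmetric]
  proof (intro sum.cong refl)
    fix \<tau> assume \<tau>: "\<tau> \<in> ?lk"
    \<comment> \<open>Faces of the link have at most \<open>d - 1\<close> vertices, so the
      subtraction is exact and one factor 1 - t splits off.\<close>
    have "d - card \<tau> = Suc (d - 1 - card \<tau>)" using card_link_le[OF \<tau>] by simp
    then have "g \<tau> = Y * (X ^ card \<tau> * Y ^ (d - 1 - card \<tau>))" by (simp add: g_def mult_ac)
    moreover have "g (insert v \<tau>) = X * (X ^ card \<tau> * Y ^ (d - 1 - card \<tau>))"
      "g (insert u \<tau>) = X * (X ^ card \<tau> * Y ^ (d - 1 - card \<tau>))"
      using g_insert[OF \<tau>] by (simp_all add: mult_ac)
    moreover have "Y + (X + X) = [:1, 1:]" by (simp add: X_def Y_def)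
    ultimately show "g \<tau> + (g (insert v \<tau>) + g (insert u \<tau>)) = [:1, 1:] * (X ^ card \<tau> * Y ^ (d - 1 - card \<tau>))"
      by (simp only: distrib_right[symmetric])
  qed
  also have "\<dots> = [:1, 1:] * h_poly (d - 1) ?lk"
    unfolding sum_distrib_left[symmetric] X_def Y_def using fin_lk card_link_le[of _ v]
    by (subst h_poly_eq_sum_faces) force+
  finally show ?thesis ..
qed

end

section \<open>The crosspolytope as an abstract complex\<close>

text \<open>A model that separates the combinatorics from convexity. For \<open>B = {}\<close> it is
  \<open>{{}}\<close>, the boundary complex of a point.\<close>

definition cross_complex :: "'a::real_vector set \<Rightarrow> 'a set set" where
  "cross_complex B = {\<sigma>. \<sigma> \<subseteq> B \<union> uminus ` B \<and> (\<forall>b\<in>B. \<not> (b \<in> \<sigma> \<and> - b \<in> \<sigma>))}"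

lemma Basis_neq_uminus: "b \<in> Basis \<Longrightarrow> b' \<in> Basis \<Longrightarrow> b \<noteq> - (b'::'a::euclidean_space)"
proof
  assume b: "b \<in> Basis" "b' \<in> Basis" "b = - b'"
  then have "b \<bullet> b' = - 1" by simp
  then show False using b(1,2) by (auto simp: inner_Basis split: if_splits)
qed

lemma pair_in_cross_complex:
  fixes B :: "'a::euclidean_space set"
  assumes "B \<subseteq> Basis" "x \<in> B \<union> uminus ` B" "x' \<in> B \<union> uminus ` B"
  shows "{x, x'} \<in> cross_complex B \<longleftrightarrow> x' \<noteq> - x"
  using assms Basis_neq_uminus unfolding cross_complex_def by fastforce

lemma vertices_cross_complex:
  fixes B :: "'a::euclidean_space set"
  assumes "B \<subseteq> Basis"
  shows "vertices_of (cross_complex B) = B \<union> uminus ` B"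
proof -
  have "x \<noteq> - x" if "x \<in> B \<union> uminus ` B" for x
    using that assms Basis_neq_uminus by fastforce
  then show ?thesis
    using pair_in_cross_complex[OF assms] unfolding vertices_of_def
    by (auto simp: cross_complex_def)
qed

lemma unique_opposite_cross_complex:
  fixes B :: "'a::euclidean_space set"
  assumes "B \<subseteq> Basis"
  shows "unique_opposite (cross_complex B)"
  unfolding unique_opposite_def vertices_cross_complex[OF assms]
proof
  fix v assume v: "v \<in> B \<union> uminus ` B"
  have neg: "- v \<in> B \<union> uminus ` B" "- v \<noteq> v"
    using v assms Basis_neq_uminus by fastforce+
  show "\<exists>!u. u \<in> B \<union> uminus ` B \<and> u \<noteq> v \<and> {u, v} \<notin> cross_complex B"
    using pair_in_cross_complex[OF assms] neg v
    by (intro ex1I[of _ "- v"]) auto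
qed

lemma unique_opposite_iso:
  assumes "complex_iso K L" and opp: "unique_opposite L" and flag: "flag_complex K"
  shows "unique_opposite K"
proof -
  obtain f where f: "bij_betw f (vertices_of K) (vertices_of L)" "L = (\<lambda>\<sigma>. f ` \<sigma>) ` K"
    using assms by (auto simp: complex_iso_def)
  have inj: "inj_on f (vertices_of K)" using f(1) by (simp add: bij_betw_def)
  have edge: "{f u, f v} \<in> L \<longleftrightarrow> {u, v} \<in> K" if "u \<in> vertices_of K" "v \<in> vertices_of K" for u v
  proof
    assume "{f u, f v} \<in> L"
    then obtain \<sigma> where "\<sigma> \<in> K" "f ` \<sigma> = f ` {u, v}" using f(2) by auto
    \<comment> \<open>\<open>f\<close> is injective on the vertices only; flagness guarantees that
      the face \<open>\<sigma>\<close> consists of vertices.\<close>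
    moreover have "\<sigma> \<subseteq> vertices_of K" using flag_faceD(2)[OF flag \<open>\<sigma> \<in> K\<close>] .
    ultimately show "{u, v} \<in> K" using inj_on_image_eq_iff[OF inj, of \<sigma> "{u, v}"] that by simp
  next
    assume "{u, v} \<in> K"
    then have "f ` {u, v} \<in> L" unfolding f(2) by (rule imageI)
    then show "{f u, f v} \<in> L" by simp
  qed
  show ?thesis
    unfolding unique_opposite_def
  proof
    fix v assume v: "v \<in> vertices_of K"
    then have "f v \<in> vertices_of L" using f(1) bij_betwE by auto
    then obtain u' where u': "u' \<in> vertices_of L" "u' \<noteq> f v" "{u', f v} \<notin> L"
      and unique: "\<And>x. x \<in> vertices_of L \<Longrightarrow> x \<noteq> f v \<Longrightarrow> {x, f v} \<notin> L \<Longrightarrow> x = u'"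
      using opp unfolding unique_opposite_def by metis
    obtain u where u: "u \<in> vertices_of K" "f u = u'" using u'(1) f(1) by (metis bij_betw_imp_surj_on imageE)
    show "\<exists>!u. u \<in> vertices_of K \<and> u \<noteq> v \<and> {u, v} \<notin> K"
    proof (rule ex1I[of _ u])
      show "u \<in> vertices_of K \<and> u \<noteq> v \<and> {u, v} \<notin> K" using u u' edge[OF u(1) v] by auto
      fix x assume x: "x \<in> vertices_of K \<and> x \<noteq> v \<and> {x, v} \<notin> K"
      then have "f x \<in> vertices_of L" "f x \<noteq> f v" "{f x, f v} \<notin> L"
        using f(1) bij_betwE inj v edge by (auto simp: inj_on_def)
      then show "x = u" using unique u x inj by (metis inj_onD)
    qed
  qed
qed

text \<open>A face \<open>F\<close> of maximal size \<open>d\<close> contains one vertex of each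
  opposite pair: if neither \<open>u\<close> nor \<open>o' u\<close> were in \<open>F\<close>, then
  \<open>u\<close> would be adjacent to all of \<open>F\<close> and \<open>insert u F\<close> would
  be a face of size \<open>d + 1\<close>. So a bijection of \<open>F\<close> with \<open>B\<close>
  extends to all vertices by sending opposites to negatives.\<close>

lemma unique_opposite_imp_iso:
  fixes B :: "'b::euclidean_space set"
  assumes flag: "flag_complex K" and opp: "unique_opposite K" and card_le: "\<And>\<sigma>. \<sigma> \<in> K \<Longrightarrow> card \<sigma> \<le> d"
    and F: "F \<in> K" "card F = d" and B: "B \<subseteq> Basis" "card B = d"
  shows "complex_iso K (cross_complex B)"
proof -
  define V where "V = vertices_of K"
  obtain o' where o': "\<And>v. v \<in> V \<Longrightarrow> o' v \<in> V \<and> o' v \<noteq> v \<and> {o' v, v} \<notin> K"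
    and o'_unique: "\<And>u v. v \<in> V \<Longrightarrow> u \<in> V \<Longrightarrow> u \<noteq> v \<Longrightarrow> {u, v} \<notin> K \<Longrightarrow> u = o' v"
    using opp unfolding unique_opposite_def V_def[symmetric] by metis
  have o'o': "o' (o' v) = v" if "v \<in> V" for v
    using o'[OF that] o'_unique[of "o' v" v] that by (metis insert_commute)
  have FV: "F \<subseteq> V" "finite F" using flag_faceD[OF flag F(1)] by (auto simp: V_def)
  have o'F: "o' u \<notin> F" if "u \<in> F" for u
    using that FV o'[of u] flag_faceD(3)[OF flag F(1), of "o' u" u] by auto
  have V_cases: "o' u \<in> F" if "u \<in> V" "u \<notin> F" for u
  proof (rule ccontr)
    assume not: "o' u \<notin> F"
    have edge: "{x, u} \<in> K" if "x \<in> F" for x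
      using o'_unique[of u x] not that \<open>u \<in> V\<close> \<open>u \<notin> F\<close> FV by auto
    have "insert u F \<in> K"
    proof (rule flag_faceI[OF flag])
      show "finite (insert u F)" "insert u F \<subseteq> vertices_of K" using FV that by (auto simp: V_def)
      fix x x' assume "x \<in> insert u F" "x' \<in> insert u F" "x \<noteq> x'"
      then show "{x, x'} \<in> K" using edge flag_faceD(3)[OF flag F(1)] by (metis insertE insert_commute)
    qed
    then show False using card_le[of "insert u F"] FV that F by simp
  qed
  have finB: "finite B" using B finite_Basis finite_subset by blast
  obtain g where g: "bij_betw g F B" using finite_same_card_bij FV finB F B by metis
  define f where "f u = (if u \<in> F then g u else - g (o' u))" for u
  have gB: "g u \<in> B" if "u \<in> F" for u using g that bij_betwE by auto
  have f_o': "f (o' u) = - f u" if "u \<in> V" for u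
    using that o'F[of u] V_cases[of u] o'o'[of u] by (auto simp: f_def)
  have f_in: "f u \<in> B \<union> uminus ` B" if "u \<in> V" for u
    using that gB V_cases by (auto simp: f_def)
  have f_B: "f u \<in> B \<longleftrightarrow> u \<in> F" if "u \<in> V" for u
  proof (cases "u \<in> F")
    case False
    then have "g (o' u) \<in> B" using gB V_cases that by blast
    then have "- g (o' u) \<notin> B" using B Basis_neq_uminus by (metis subsetD)
    then show ?thesis using False by (simp add: f_def)
  qed (use gB in \<open>simp add: f_def\<close>)
  have inj: "inj_on f V"
  proof (rule inj_onI)
    fix u u' assume u: "u \<in> V" "u' \<in> V" and eq: "f u = f u'"
    have g_inj: "x = x'" if "g x = g x'" "x \<in> F" "x' \<in> F" for x x'
      using g that by (auto simp: bij_betw_def inj_on_def)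
    show "u = u'"
    proof (cases "u \<in> F")
      case True
      then have "u' \<in> F" using f_B u eq by metis
      then show ?thesis using True eq g_inj by (simp add: f_def)
    next
      case False
      then have "u' \<notin> F" using f_B u eq by metis
      then have "o' u = o' u'" using False eq g_inj V_cases u by (simp add: f_def)
      then show ?thesis using o'o' u by metis
    qed
  qed
  have img: "f ` V = B \<union> uminus ` B"
  proof
    have "b \<in> f ` V \<and> - b \<in> f ` V" if b: "b \<in> B" for b
    proof -
      obtain u where u: "u \<in> F" "g u = b" using g b by (metis bij_betw_imp_surj_on imageE)
      then have "f u = b" "f (o' u) = - b" "u \<in> V" "o' u \<in> V"
        using FV f_o'[of u] o'[of u] by (auto simp: f_def)
      then show ?thesis by (metis imageI)
    qed
    then show "B \<union> uminus ` B \<subseteq> f ` V" by auto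
  qed (use f_in in auto)
  have edge: "{u, u'} \<in> K \<longleftrightarrow> f u' \<noteq> - f u" if "u \<in> V" "u' \<in> V" "u \<noteq> u'" for u u'
  proof -
    have "f u' = - f u \<longleftrightarrow> u' = o' u"
      using f_o'[OF that(1)] o'[OF that(1)] inj that by (metis inj_onD)
    moreover have "{u, u'} \<in> K \<longleftrightarrow> u' \<noteq> o' u"
      using that o'[OF that(1)] o'_unique[of u u'] by (metis insert_commute)
    ultimately show ?thesis by blast
  qed
  have "cross_complex B = (\<lambda>\<sigma>. f ` \<sigma>) ` K"
  proof (intro equalityI subsetI)
    fix \<tau> assume \<tau>: "\<tau> \<in> cross_complex B"
    define \<sigma> where "\<sigma> = {u \<in> V. f u \<in> \<tau>}"
    have f\<sigma>: "f ` \<sigma> = \<tau>" using \<tau> img by (auto simp: \<sigma>_def cross_complex_def)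
    have "\<sigma> \<in> K"
    proof (rule flag_faceI[OF flag])
      have "finite \<tau>" using \<tau> finB finite_subset by (auto simp: cross_complex_def)
      then show "finite \<sigma>" using f\<sigma> inj by (metis (no_types, lifting) \<sigma>_def finite_imageD inj_on_subset mem_Collect_eq subsetI)
      show "\<sigma> \<subseteq> vertices_of K" by (auto simp: \<sigma>_def V_def)
      fix u u' assume u: "u \<in> \<sigma>" "u' \<in> \<sigma>" "u \<noteq> u'"
      have "f u' \<noteq> - f u"
        using u \<tau> f_in[of u] by (auto simp: \<sigma>_def cross_complex_def)
      then show "{u, u'} \<in> K" using edge u by (simp add: \<sigma>_def)
    qed
    then show "\<tau> \<in> (\<lambda>\<sigma>. f ` \<sigma>) ` K" using f\<sigma> by blast
  next
    fix \<tau> assume "\<tau> \<in> (\<lambda>\<sigma>. f ` \<sigma>) ` K"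
    then obtain \<sigma> where \<sigma>: "\<sigma> \<in> K" "\<tau> = f ` \<sigma>" by auto
    have \<sigma>V: "\<sigma> \<subseteq> V" using flag_faceD(2)[OF flag \<sigma>(1)] by (simp add: V_def)
    have "\<not> (b \<in> \<tau> \<and> - b \<in> \<tau>)" if b: "b \<in> B" for b
    proof
      assume "b \<in> \<tau> \<and> - b \<in> \<tau>"
      then obtain u u' where u: "u \<in> \<sigma>" "u' \<in> \<sigma>" "f u = b" "f u' = - b" using \<sigma> by (metis imageE)
      then have "u \<noteq> u'" using b B Basis_neq_uminus by (metis subsetD)
      then have "{u, u'} \<in> K" using flag_faceD(3)[OF flag \<sigma>(1)] u by blast
      then show False using edge[of u u'] u \<sigma>V \<open>u \<noteq> u'\<close> by auto
    qed
    moreover have "\<tau> \<subseteq> B \<union> uminus ` B" using \<sigma>(2) \<sigma>V img by blast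
    ultimately show "\<tau> \<in> cross_complex B"
      unfolding cross_complex_def by blast
  qed
  moreover have "bij_betw f (vertices_of K) (vertices_of (cross_complex B))"
    using inj img by (simp add: bij_betw_def vertices_cross_complex[OF B(1)] V_def)
  ultimately show ?thesis unfolding complex_iso_def by blast
qed

subsection \<open>Boundary complexes of polytopes\<close>

text \<open>The coordinate functional is represented by the vector \<open>adjoint g 1\<close>;
  projecting it orthogonally to the span changes none of its pairings with the
  \<open>p u'\<close>.\<close>

lemma ex_dual_basis:
  fixes p :: "'v \<Rightarrow> 'e::euclidean_space"
  assumes inj: "inj_on p F" and indep: "independent (p ` F)"
  obtains y where "\<And>u. u \<in> F \<Longrightarrow> y u \<in> span (p ` F)"
    "\<And>u u'. u \<in> F \<Longrightarrow> u' \<in> F \<Longrightarrow> y u \<bullet> p u' = (if u' = u then 1 else 0)"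
proof -
  have "\<exists>z\<in>span (p ` F). \<forall>u'\<in>F. z \<bullet> p u' = (if u' = u then 1 else 0)" if u: "u \<in> F" for u
  proof -
    obtain g :: "'e \<Rightarrow> real" where g: "linear g" "\<And>x. x \<in> p ` F \<Longrightarrow> g x = (if x = p u then 1 else 0)"
      using linear_independent_extend[OF indep, of "\<lambda>x. if x = p u then 1 else 0 :: real"] by blast
    obtain z z' where z: "z \<in> span (p ` F)" "\<And>w. w \<in> span (p ` F) \<Longrightarrow> orthogonal z' w"
        "adjoint g 1 = z + z'"
      using orthogonal_subspace_decomp_exists[of "p ` F" "adjoint g 1"] by blast
    have "z \<bullet> p u' = (if u' = u then 1 else 0)" if u': "u' \<in> F" for u'
    proof -
      have "z \<bullet> p u' = adjoint g 1 \<bullet> p u'"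
        using z(2)[of "p u'"] u' by (simp add: z(3) inner_add_left orthogonal_def span_base)
      also have "\<dots> = g (p u')"
        using adjoint_works[OF g(1), of "p u'" 1] by (simp add: inner_commute)
      also have "\<dots> = (if u' = u then 1 else 0)"
        using g(2)[of "p u'"] inj u u' by (simp add: inj_on_eq_iff)
      finally show ?thesis .
    qed
    with z(1) show ?thesis by blast
  qed
  then show ?thesis using that by metis
qed

definition vertex_set :: "'a::euclidean_space set \<Rightarrow> 'a set" where
  "vertex_set G = {v. v extreme_point_of G}"

lemma boundary_complex_alt:
  "boundary_complex P = vertex_set ` {G. G face_of P \<and> G \<noteq> P}"
  by (auto simp: boundary_complex_def vertex_set_def)

lemma vertex_set_face:
  "F face_of S \<Longrightarrow> vertex_set F = vertex_set S \<inter> F"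
  by (auto simp: vertex_set_def extreme_point_of_face)

lemma simplicial_polytope_face:
  fixes P :: "'a::euclidean_space set"
  assumes "simplicial_polytope P" "G face_of P" "G \<noteq> P"
  shows "\<not> affine_dependent (vertex_set G)" "convex hull (vertex_set G) = G"
proof -
  obtain C where "\<not> affine_dependent C" "G = convex hull C"
    using assms by (auto simp: simplicial_polytope_def simplex_def)
  moreover from this have "vertex_set G = C"
    by (simp add: vertex_set_def extreme_point_of_convex_hull_affine_independent)
  ultimately show "\<not> affine_dependent (vertex_set G)" "convex hull (vertex_set G) = G" by auto
qed

text \<open>\<open>c\<close> lies strictly below the exposing hyperplane, being in no proper face.
  Rescaling to height 1 makes the functionals of different facets comparable, as the shelling order
  requires.\<close>

lemma facet_supporting_vector:
  fixes P :: "'a::euclidean_space set"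
  assumes P: "polyhedron P" and c: "c \<in> rel_interior P" and G: "G face_of P" "G \<noteq> P" "G \<noteq> {}"
  obtains a where "\<And>x. x \<in> P \<Longrightarrow> a \<bullet> (x - c) \<le> 1" "\<And>x. x \<in> P \<Longrightarrow> a \<bullet> (x - c) = 1 \<longleftrightarrow> x \<in> G"
proof -
  obtain a b where ab: "P \<subseteq> {x. a \<bullet> x \<le> b}" "G = P \<inter> {x. a \<bullet> x = b}"
    using exposed_face_of_polyhedron[OF P, of G] G(1) unfolding exposed_face_of_def by blast
  have "c \<in> P" using c rel_interior_subset by blast
  moreover have "c \<notin> G" using face_of_disjoint_rel_interior[OF G(1,2)] c by blast
  ultimately have pos: "0 < b - a \<bullet> c" using ab by force
  define a' where "a' = (1 / (b - a \<bullet> c)) *\<^sub>R a"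
  have a': "a' \<bullet> (x - c) = (a \<bullet> x - a \<bullet> c) / (b - a \<bullet> c)" for x
    by (simp add: a'_def inner_diff_right diff_divide_distrib)
  show ?thesis
  proof
    fix x assume "x \<in> P"
    then have "a \<bullet> x \<le> b" using ab by blast
    then show "a' \<bullet> (x - c) \<le> 1" using pos by (simp add: a' divide_le_eq)
    show "a' \<bullet> (x - c) = 1 \<longleftrightarrow> x \<in> G" using pos ab \<open>x \<in> P\<close> by (auto simp: a' field_simps)
  qed
qed

text \<open>With a relative interior point \<open>c\<close> as origin, the cones over the facets
  cover \<open>E\<close>, since every ray from \<open>c\<close> leaves \<open>P\<close> through a
  facet. Simpliciality makes the vertices of a facet a basis of \<open>E\<close> and every subset of
  them a face.\<close>

lemma simplicial_polytope_fan:
  fixes P :: "'a::euclidean_space set"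
  assumes simp: "simplicial_polytope P" and dim: "aff_dim P = int d" and d: "d > 0"
  obtains V p E \<F> a y where "simplicial_fan V p (E :: 'a set) \<F> d a y"
    "boundary_complex P = simplicial_fan.\<Delta> \<F>"
proof -
  have polyt: "polytope P" and poly: "polyhedron P"
    using simp by (auto simp: simplicial_polytope_def polytope_imp_polyhedron)
  have "P \<noteq> {}" using dim by auto
  then obtain c where c: "c \<in> rel_interior P"
    using polyt by (metis all_not_in_conv polytope_imp_convex rel_interior_eq_empty)
  then have cP: "c \<in> P" using rel_interior_subset by blast
  define \<F> where "\<F> = vertex_set ` {G. G facet_of P}"
  define p where "p u = u - c" for u
  define E where "E = span (p ` P)"
  define V where "V = \<Union>\<F>"
  have dimE: "dim E = d"
    using aff_dim_eq_dim_subtract[OF hull_inc[OF cP]] dim by (simp add: E_def p_def[abs_def])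
  have facet: "G face_of P" "G \<noteq> P" "G \<noteq> {}" "vertex_set G = vertex_set P \<inter> G"
    "\<not> affine_dependent (vertex_set G)" "convex hull (vertex_set G) = G" "card (vertex_set G) = d"
    "finite (vertex_set G)" if "G facet_of P" for G
  proof -
    show G: "G face_of P" "G \<noteq> P" "G \<noteq> {}" using that by (auto simp: facet_of_def)
    show "vertex_set G = vertex_set P \<inter> G" by (rule vertex_set_face[OF G(1)])
    show indep: "\<not> affine_dependent (vertex_set G)" and conv: "convex hull (vertex_set G) = G"
      using simplicial_polytope_face[OF simp G(1,2)] by auto
    then show "finite (vertex_set G)" using aff_independent_finite by blast
    have "aff_dim (vertex_set G) = int d - 1"
      using conv that dim aff_dim_convex_hull[of "vertex_set G"] by (simp add: facet_of_def)
    then show "card (vertex_set G) = d" using aff_dim_affine_independent[OF indep] by simp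
  qed
  have V_P: "V \<subseteq> vertex_set P" using facet(4) by (auto simp: V_def \<F>_def)
  have vP: "vertex_set P \<subseteq> P" by (auto simp: vertex_set_def extreme_point_of_def)
  have "\<exists>a. \<forall>x\<in>P. a \<bullet> (x - c) \<le> 1 \<and> (a \<bullet> (x - c) = 1 \<longleftrightarrow> x \<in> G)" if "G facet_of P" for G
    using facet_supporting_vector[OF poly c facet(1-3)[OF that]] by metis
  then obtain a where a: "\<And>G x. G facet_of P \<Longrightarrow> x \<in> P \<Longrightarrow> a G \<bullet> p x \<le> 1 \<and> (a G \<bullet> p x = 1 \<longleftrightarrow> x \<in> G)"
    unfolding p_def by metis
  have inj_p: "inj_on p F" for F by (auto simp: p_def inj_on_def)
  have indep: "independent (p ` vertex_set G)" if G: "G facet_of P" for G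
  proof -
    \<comment> \<open>The facet lies at height 1 and \<open>c\<close> at height 0, so adding
      \<open>c\<close> keeps the vertices affinely independent; with \<open>c\<close> as origin this
      is linear independence.\<close>
    have "affine hull vertex_set G \<subseteq> {x. a G \<bullet> x = 1 + a G \<bullet> c}"
    proof (rule hull_minimal)
      show "vertex_set G \<subseteq> {x. a G \<bullet> x = 1 + a G \<bullet> c}"
        using a[OF G] facet(4)[OF G] vP by (auto simp: p_def inner_diff_right algebra_simps)
    qed (rule affine_hyperplane)
    then have "c \<notin> affine hull vertex_set G" by auto
    then have "\<not> affine_dependent (insert c (vertex_set G))" "c \<notin> vertex_set G"
      using affine_independent_insert[OF facet(5)[OF G]] hull_subset[of "vertex_set G" affine] by blast+
    moreover have "(\<lambda>x. - c + x) ` vertex_set G = p ` vertex_set G" by (simp add: p_def[abs_def])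
    ultimately show ?thesis using affine_dependent_iff_dependent by metis
  qed
  have span_eq: "span (p ` vertex_set G) = E" if G: "G facet_of P" for G
  proof (rule antisym)
    have "p ` vertex_set G \<subseteq> p ` P" using facet(4)[OF G] vP by auto
    then have sub: "p ` vertex_set G \<subseteq> E" unfolding E_def using span_superset by blast
    then show "span (p ` vertex_set G) \<subseteq> E" unfolding E_def by (simp add: span_minimal)
    show "E \<subseteq> span (p ` vertex_set G)"
      using sub indep[OF G] dimE facet(7)[OF G] card_image[OF inj_p]
      by (intro card_ge_dim_independent) auto
  qed
  have "\<exists>y. \<forall>u\<in>vertex_set G. y u \<in> E \<and> (\<forall>u'\<in>vertex_set G. y u \<bullet> p u' = (if u' = u then 1 else 0))"
    if G: "G facet_of P" for G
    using ex_dual_basis[OF inj_p indep[OF G]] unfolding span_eq[OF G] by metis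
  then obtain y where y: "\<And>G u. G facet_of P \<Longrightarrow> u \<in> vertex_set G \<Longrightarrow> y G u \<in> E"
    "\<And>G u u'. G facet_of P \<Longrightarrow> u \<in> vertex_set G \<Longrightarrow> u' \<in> vertex_set G \<Longrightarrow>
        y G u \<bullet> p u' = (if u' = u then 1 else 0)"
    by metis
  \<comment> \<open>The fan is indexed by vertex sets, while \<open>a\<close> and \<open>y\<close>
    were chosen for facets; the convex hull translates back.\<close>
  define face where "face F = convex hull F" for F :: "'a set"
  have face: "face F facet_of P" "vertex_set (face F) = F" if "F \<in> \<F>" for F
    using that facet(6) by (auto simp: \<F>_def face_def)

  have ex_facet: "\<exists>G. G facet_of P \<and> H \<subseteq> G" if H: "H face_of P" "H \<noteq> P" for H
  proof (cases "H = {}")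
    case False
    then show ?thesis using face_of_polyhedron_subset_facet[OF poly H(1) False H(2)] by metis
  next
    case True
    \<comment> \<open>The empty face needs some facet above it. A single point has none; otherwise
      any ray from \<open>c\<close> towards another point of \<open>P\<close> hits one.\<close>
    have "P \<noteq> {c}" using dim d by auto
    then obtain z where "z \<in> P" "z \<noteq> c" using cP by blast
    then have "z - c \<noteq> 0" "c + (z - c) \<in> affine hull P" by (auto intro: hull_inc)
    then obtain t where "c + t *\<^sub>R (z - c) \<in> rel_frontier P"
      using ray_to_rel_frontier[OF polytope_imp_bounded[OF polyt] c] by metis
    then show ?thesis using True rel_frontier_of_polyhedron[OF poly] by auto
  qed

  have "simplicial_fan V p E \<F> d (\<lambda>F. a (face F)) (\<lambda>F. y (face F))"
  proof
    have "finite {G. G facet_of P}"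
      using finite_polyhedron_facets[OF poly] .
    then show "finite V" using facet(8) by (auto simp: V_def \<F>_def)
    show "V = \<Union>\<F>" by (simp add: V_def)
    show "subspace E" by (simp add: E_def)
    show "p u \<in> E" if "u \<in> V" for u using that V_P vP by (auto simp: E_def intro: span_base)
    fix F assume F: "F \<in> \<F>"
    note f = face[OF F]
    show "card F = d" using facet(7)[OF f(1)] f(2) by simp
    show "y (face F) u \<in> E" if "u \<in> F" for u using y(1)[OF f(1)] f(2) that by simp
    show "y (face F) u \<bullet> p u' = (if u' = u then 1 else 0)" if "u \<in> F" "u' \<in> F" for u u'
      using y(2)[OF f(1)] f(2) that by simp
    show "x = (\<Sum>u\<in>F. (y (face F) u \<bullet> x) *\<^sub>R p u)" if "x \<in> E" for x
    proof -
      have fin: "finite F" using facet(8)[OF f(1)] f(2) by simp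
      have "x \<in> span (p ` F)" using span_eq[OF f(1)] f(2) that by simp
      then obtain k where "x = (\<Sum>v\<in>p ` F. k v *\<^sub>R v)"
        using span_finite[of "p ` F"] fin by auto
      then have x: "x = (\<Sum>u\<in>F. k (p u) *\<^sub>R p u)" by (simp add: sum.reindex[OF inj_p])
      have "y (face F) u \<bullet> x = k (p u)" if "u \<in> F" for u
      proof -
        have "y (face F) u \<bullet> x = (\<Sum>u'\<in>F. if u' = u then k (p u') else 0)"
          unfolding x inner_sum_right using y(2)[OF f(1)] f(2) that by (intro sum.cong) auto
        then show ?thesis using fin that by simp
      qed
      then show ?thesis using x by simp
    qed
    show "a (face F) \<bullet> p u = 1" if "u \<in> F" for u
      using a[OF f(1), of u] facet(4)[OF f(1)] f(2) vP that by auto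
    show "a (face F) \<bullet> p u < 1" if "u \<in> V" "u \<notin> F" for u
    proof -
      have "u \<in> P" "u \<notin> face F" using that V_P vP facet(4)[OF f(1)] f(2) by auto
      then show ?thesis using a[OF f(1), of u] by auto
    qed
  next
    fix x assume x: "x \<in> E"
    show "\<exists>F\<in>\<F>. \<exists>k. (\<forall>u\<in>F. 0 \<le> k u) \<and> x = (\<Sum>u\<in>F. k u *\<^sub>R p u)"
    proof (cases "x = 0")
      case True
      obtain G where "G facet_of P" using ex_facet[of "{}"] \<open>P \<noteq> {}\<close> by auto
      then have "vertex_set G \<in> \<F>" by (auto simp: \<F>_def)
      then show ?thesis using True by (intro bexI exI[of _ "\<lambda>_. 0"]) auto
    next
      case False
      have "c + x \<in> affine hull P"
        using x affine_hull_span_gen[OF hull_inc[OF cP]] by (simp add: E_def p_def[abs_def])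
      then obtain t where t: "0 < t" "c + t *\<^sub>R x \<in> rel_frontier P"
        using ray_to_rel_frontier[OF polytope_imp_bounded[OF polyt] c _ False] by metis
      then obtain G where G: "G facet_of P" "c + t *\<^sub>R x \<in> G"
        using rel_frontier_of_polyhedron[OF poly] by auto
      define F where "F = vertex_set G"
      have fin: "finite F" using facet(8)[OF G(1)] by (simp add: F_def)
      have "c + t *\<^sub>R x \<in> convex hull F" using facet(6)[OF G(1)] G(2) by (simp add: F_def)
      then obtain k where k: "\<forall>u\<in>F. 0 \<le> k u" "sum k F = 1" "(\<Sum>u\<in>F. k u *\<^sub>R u) = c + t *\<^sub>R x"
        unfolding convex_hull_finite[OF fin] by auto
      have "(\<Sum>u\<in>F. k u *\<^sub>R p u) = (\<Sum>u\<in>F. k u *\<^sub>R u) - sum k F *\<^sub>R c"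
        by (simp add: p_def scaleR_diff_right sum_subtractf scaleR_left.sum)
      then have "t *\<^sub>R x = (\<Sum>u\<in>F. k u *\<^sub>R p u)" using k by simp
      then have "(1 / t) *\<^sub>R (t *\<^sub>R x) = (\<Sum>u\<in>F. (k u / t) *\<^sub>R p u)" by (simp add: scaleR_sum_right)
      then have "x = (\<Sum>u\<in>F. (k u / t) *\<^sub>R p u)" using t by simp
      moreover have "F \<in> \<F>" using G by (simp add: F_def \<F>_def)
      ultimately show ?thesis using k(1) t by (intro bexI[of _ F] exI[of _ "\<lambda>u. k u / t"]) auto
    qed
  qed
  moreover have "boundary_complex P = {\<sigma>. \<exists>F\<in>\<F>. \<sigma> \<subseteq> F}"
  proof (intro equalityI subsetI)
    fix \<sigma> assume "\<sigma> \<in> boundary_complex P"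
    then obtain H where H: "H face_of P" "H \<noteq> P" "\<sigma> = vertex_set H"
      by (auto simp: boundary_complex_alt)
    then obtain G where G: "G facet_of P" "H \<subseteq> G" using ex_facet by blast
    then have "\<sigma> \<subseteq> vertex_set G" using H vertex_set_face[OF H(1)] facet(4)[OF G(1)] by auto
    then show "\<sigma> \<in> {\<sigma>. \<exists>F\<in>\<F>. \<sigma> \<subseteq> F}" using G by (auto simp: \<F>_def)
  next
    fix \<sigma> assume "\<sigma> \<in> {\<sigma>. \<exists>F\<in>\<F>. \<sigma> \<subseteq> F}"
    then obtain G where G: "G facet_of P" "\<sigma> \<subseteq> vertex_set G" by (auto simp: \<F>_def)
    have "convex hull \<sigma> face_of convex hull (vertex_set G)"
      using face_of_convex_hull_affine_independent[OF facet(5)[OF G(1)]] G(2) by blast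
    then have *: "convex hull \<sigma> face_of P" "convex hull \<sigma> \<subseteq> G"
      using facet(6)[OF G(1)] facet(1)[OF G(1)] face_of_trans face_of_imp_subset by metis+
    have "convex hull \<sigma> \<noteq> P" using *(2) facet(1,2)[OF G(1)] face_of_imp_subset by blast
    moreover have "vertex_set (convex hull \<sigma>) = \<sigma>"
    proof -
      have "\<not> affine_dependent \<sigma>"
        using affine_dependent_subset[OF _ G(2)] facet(5)[OF G(1)] by blast
      then show ?thesis
        by (simp add: vertex_set_def extreme_point_of_convex_hull_affine_independent)
    qed
    ultimately show "\<sigma> \<in> boundary_complex P" using *(1) unfolding boundary_complex_alt by blast
  qed
  ultimately show ?thesis
    using that simplicial_fan.\<Delta>_def by metis
qed

text \<open>A face containing \<open>s\<close> and \<open>- s\<close> contains 0, which lies between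
  every antipodal pair, so it is all of \<open>Q\<close>. Conversely, if \<open>\<sigma>\<close> has
  no antipodal pair, the functional \<open>\<Sum>\<sigma>\<close> is at most 1 on the vertices, with
  equality exactly on \<open>\<sigma>\<close>.\<close>

lemma boundary_crosspolytope:
  fixes B :: "'a::euclidean_space set"
  assumes B: "B \<subseteq> Basis"
  shows "boundary_complex (convex hull (insert 0 (B \<union> uminus ` B))) = cross_complex B"
proof (cases "B = {}")
  case True
  have "{G :: 'a set. G face_of {0} \<and> G \<noteq> {0}} = {{}}"
    using face_of_imp_subset empty_face_of by auto
  moreover have "vertex_set ({} :: 'a set) = {}"
    by (auto simp: vertex_set_def extreme_point_of_def)
  moreover have "cross_complex ({} :: 'a set) = {{}}"
    by (auto simp: cross_complex_def)
  ultimately show ?thesis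
    using True by (simp add: boundary_complex_alt)
next
  case False
  define S where "S = B \<union> uminus ` B"
  define Q where "Q = convex hull (insert 0 S)"
  have finB: "finite B" using B finite_Basis finite_subset by blast
  have S_uminus: "- s \<in> S" if "s \<in> S" for s using that by (auto simp: S_def)
  have SQ: "S \<subseteq> Q" "0 \<in> Q" using hull_subset[of "insert 0 S" convex] by (auto simp: Q_def)
  have convQ: "convex Q" by (simp add: Q_def)
  have inner_S: "s \<bullet> s' = (if s = s' then 1 else 0) - (if s = - s' then 1 else 0)"
    if "s \<in> S" "s' \<in> S" for s s'
  proof -
    have *: "b \<bullet> b' = (if b = b' then 1 else 0)" "b \<noteq> - b'" "- b \<noteq> b'" if "b \<in> B" "b' \<in> B" for b b'
      using that B Basis_neq_uminus[of b b'] Basis_neq_uminus[of b' b] by (auto simp: inner_Basis subset_eq)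
    show ?thesis
      using that * unfolding S_def by auto
  qed
  have "0 \<notin> S" using B nonzero_Basis by (auto simp: S_def)
  have zero_seg: "0 \<in> open_segment s (- s)" if "s \<in> S" for s
  proof -
    have "s \<noteq> - s" using inner_S[OF that that] that \<open>0 \<notin> S\<close> by (auto split: if_splits)
    then show ?thesis
      using midpoint_in_open_segment[of s "- s"] by (simp add: midpoint_def)
  qed
  have le_hull: "z \<bullet> q \<le> 1" if "\<And>s. s \<in> S \<Longrightarrow> z \<bullet> s \<le> 1" "q \<in> Q" for z q
  proof -
    have "Q \<subseteq> {x. z \<bullet> x \<le> 1}"
      unfolding Q_def using that(1) by (intro hull_minimal convex_halfspace_le) auto
    then show ?thesis using that(2) by blast
  qed
  have expose: "Q \<inter> {x. z \<bullet> x = 1} face_of Q" if "\<And>s. s \<in> S \<Longrightarrow> z \<bullet> s \<le> 1" for z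
    using le_hull[OF that] by (intro face_of_Int_supporting_hyperplane_le[OF convQ]) auto
  have vQ: "vertex_set Q = S"
  proof (intro equalityI subsetI)
    fix x assume "x \<in> vertex_set Q"
    then have x: "x extreme_point_of Q" by (simp add: vertex_set_def)
    then have "x \<in> insert 0 S" unfolding Q_def by (rule extreme_point_of_convex_hull)
    moreover obtain s where "s \<in> S" using False by (auto simp: S_def)
    then have "x \<noteq> 0"
      using x zero_seg S_uminus SQ unfolding extreme_point_of_def by blast
    ultimately show "x \<in> S" by simp
  next
    fix s assume s: "s \<in> S"
    have ss: "s \<bullet> s = 1" using inner_S[OF s s] s \<open>0 \<notin> S\<close> by (auto split: if_splits)
    have le1: "s \<bullet> s' \<le> 1" if "s' \<in> S" for s' using inner_S[OF s that] by auto
    have norm1: "norm s' = 1" if "s' \<in> S" for s'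
      using that B by (auto simp: S_def subset_eq)
    have "Q \<subseteq> cball 0 1"
      unfolding Q_def using norm1 by (intro hull_minimal convex_cball) auto
    \<comment> \<open>The hyperplane \<open>s \<bullet> x = 1\<close> touches the unit ball only at
      \<open>s\<close>, so \<open>{s}\<close> is an exposed face of \<open>Q\<close>.\<close>
    have "q = s" if q: "q \<in> Q" "s \<bullet> q = 1" for q
    proof -
      have "norm q \<le> 1" using q \<open>Q \<subseteq> cball 0 1\<close> by auto
      then have "q \<bullet> q \<le> 1" by (simp add: dot_square_norm power_le_one)
      then have "(q - s) \<bullet> (q - s) \<le> 0"
        using q(2) ss by (simp add: inner_diff_left inner_diff_right inner_commute)
      then show ?thesis by (metis eq_iff_diff_eq_0 inner_eq_zero_iff inner_ge_zero order_antisym)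
    qed
    then have "Q \<inter> {x. s \<bullet> x = 1} = {s}" using SQ s ss by auto
    then have "{s} face_of Q" using expose[OF le1] by simp
    then show "s \<in> vertex_set Q" by (simp add: vertex_set_def face_of_singleton)
  qed
  have "boundary_complex Q = cross_complex B"
  proof (intro equalityI subsetI)
    fix \<sigma> assume "\<sigma> \<in> boundary_complex Q"
    then obtain F where F: "F face_of Q" "F \<noteq> Q" "\<sigma> = vertex_set F"
      by (auto simp: boundary_complex_alt)
    have \<sigma>: "\<sigma> = S \<inter> F" using vertex_set_face[OF F(1)] F(3) vQ by simp
    have "\<not> (b \<in> \<sigma> \<and> - b \<in> \<sigma>)" if b: "b \<in> B" for b
    proof
      assume "b \<in> \<sigma> \<and> - b \<in> \<sigma>"
      then have bF: "b \<in> F" "- b \<in> F" "b \<in> S" using \<sigma> by auto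
      have "convex F" using F(1) face_of_imp_convex convQ by blast
      then have "open_segment b (- b) \<subseteq> F"
        using bF by (meson convex_contains_open_segment)
      then have F0: "0 \<in> F" using zero_seg[OF bF(3)] by blast
      have "s \<in> F" if "s \<in> S" for s
        using face_ofD[OF F(1) zero_seg[OF that]] F0 SQ that S_uminus by blast
      then have "Q \<subseteq> F"
        unfolding Q_def using F0 \<open>convex F\<close> by (intro hull_minimal) auto
      then show False using F face_of_imp_subset by blast
    qed
    then show "\<sigma> \<in> cross_complex B" using \<sigma> by (auto simp: cross_complex_def S_def)
  next
    fix \<sigma> assume \<sigma>: "\<sigma> \<in> cross_complex B"
    then have \<sigma>S: "\<sigma> \<subseteq> S" by (simp add: cross_complex_def S_def)
    then have fin: "finite \<sigma>" using finB finite_subset by (auto simp: S_def)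
    have anti: "- s \<notin> \<sigma>" if "s \<in> \<sigma>" for s
      using that \<sigma> by (auto simp: cross_complex_def)
    define z where "z = \<Sum>\<sigma>"
    have z: "z \<bullet> s' = (if s' \<in> \<sigma> then 1 else 0) - (if - s' \<in> \<sigma> then 1 else 0)" if "s' \<in> S" for s'
    proof -
      have "z \<bullet> s' = (\<Sum>s\<in>\<sigma>. (if s = s' then 1 else 0) - (if s = - s' then 1 else 0))"
        unfolding z_def inner_sum_left using inner_S that \<sigma>S by (intro sum.cong) auto
      then show ?thesis using fin by (simp add: sum_subtractf)
    qed
    have z_le: "z \<bullet> s' \<le> 1" and z_eq: "z \<bullet> s' = 1 \<longleftrightarrow> s' \<in> \<sigma>" if "s' \<in> S" for s'
      using z[OF that] anti[of s'] by auto
    have face: "Q \<inter> {x. z \<bullet> x = 1} face_of Q" using expose[OF z_le] .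
    moreover have "0 \<notin> Q \<inter> {x. z \<bullet> x = 1}" by simp
    then have "Q \<inter> {x. z \<bullet> x = 1} \<noteq> Q" using SQ(2) by metis
    moreover have "vertex_set (Q \<inter> {x. z \<bullet> x = 1}) = \<sigma>"
      unfolding vertex_set_face[OF face] vQ using SQ z_eq \<sigma>S by auto
    ultimately show "\<sigma> \<in> boundary_complex Q" unfolding boundary_complex_alt by blast
  qed
  then show ?thesis by (simp add: Q_def S_def)
qed

lemma crosspolytope_boundary_iff:
  fixes L :: "'a::euclidean_space set set"
  shows "(\<exists>Q :: 'a set. crosspolytope d Q \<and> complex_iso K (boundary_complex Q)) \<longleftrightarrow>
    (\<exists>B :: 'a set. B \<subseteq> Basis \<and> card B = d \<and> complex_iso K (cross_complex B))"
  unfolding crosspolytope_def using boundary_crosspolytope by (metis (no_types, lifting))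

theorem theorem1p6:
  fixes P :: "'a::euclidean_space set" and d :: nat and \<Delta> :: "'a set set"
  assumes "simplicial_polytope P"
    and "aff_dim P = int d"
    and "\<Delta> = boundary_complex P"
    and "flag_complex \<Delta>"
  shows "(\<forall>i. coeff ([:1, 1:] * (\<Sum>v\<in>vertices_of \<Delta>. h_poly (d - 1) (vertex_link \<Delta> v))) i
            \<le> coeff (of_nat (card (vertices_of \<Delta>)) * h_poly d \<Delta>) i)
       \<and> ([:1, 1:] * (\<Sum>v\<in>vertices_of \<Delta>. h_poly (d - 1) (vertex_link \<Delta> v))
             = of_nat (card (vertices_of \<Delta>)) * h_poly d \<Delta>
           \<longleftrightarrow> (\<exists>Q :: 'a set. crosspolytope d Q \<and> complex_iso \<Delta> (boundary_complex Q)))"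
proof (cases "d = 0")
  case True
  \<comment> \<open>A point has no facets from which to build a fan. Here both sides vanish and
    \<open>\<Delta>\<close> is the complex of the empty \<open>B\<close>, so both sides of the
    equivalence hold.\<close>
  then obtain x where "P = {x}" using assms(2) aff_dim_eq_0[of P] by auto
  then have "{G. G face_of P \<and> G \<noteq> P} = {{}}"
    using face_of_imp_subset empty_face_of by auto
  moreover have "vertex_set ({} :: 'a set) = {}"
    by (auto simp: vertex_set_def extreme_point_of_def)
  ultimately have \<Delta>: "\<Delta> = {{}}"
    unfolding assms(3) boundary_complex_alt by simp
  then have "vertices_of \<Delta> = {}" by (simp add: vertices_of_def)
  moreover have "cross_complex ({} :: 'a set) = {{}}"
    by (auto simp: cross_complex_def)
  then have "complex_iso \<Delta> (cross_complex ({} :: 'a set))"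
    unfolding \<Delta> complex_iso_def vertices_of_def by (simp add: bij_betw_def)
  ultimately show ?thesis
    unfolding crosspolytope_boundary_iff using True
    by (auto intro!: exI[of _ "{}"])
next
  case False
  then obtain V p E \<F> a y where "simplicial_fan V p (E :: 'a set) \<F> d a y"
    and \<Delta>_eq: "\<Delta> = simplicial_fan.\<Delta> \<F>"
    using simplicial_polytope_fan[OF assms(1,2)] assms(3) by blast
  then interpret fan: simplicial_fan V p E \<F> d a y by simp
  note flag = assms(4)
  let ?V = "vertices_of \<Delta>" and ?f = "\<lambda>v. [:1, 1:] * h_poly (d - 1) (vertex_link \<Delta> v)"
  have V: "?V = V" unfolding \<Delta>_eq by (rule fan.vertices_\<Delta>)
  have finV: "finite ?V" unfolding V by (rule fan.finite_V)
  have fin: "finite \<Delta>"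
  proof (rule finite_subset)
    show "\<Delta> \<subseteq> Pow V" unfolding \<Delta>_eq fan.\<Delta>_def using fan.facet_subset by blast
  qed (simp add: fan.finite_V)
  have card_le: "card \<sigma> \<le> d" if "\<sigma> \<in> \<Delta>" for \<sigma>
    using that fan.card_facet fan.finite_facet card_mono unfolding \<Delta>_eq fan.\<Delta>_def by blast
  \<comment> \<open>Completeness at the origin serves to produce some facet.\<close>
  obtain F where F: "F \<in> \<Delta>" "card F = d"
    using fan.complete[OF subspace_0[OF fan.subspace_E]] fan.facet_in_\<Delta> fan.card_facet
    unfolding \<Delta>_eq by blast
  have ineq: "coeff (?f v) i \<le> coeff (h_poly d \<Delta>) i" if "v \<in> ?V" for v i
    using fan.vertex_inequality[of v i] flag that V unfolding \<Delta>_eq by blast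
  have lhs: "[:1, 1:] * (\<Sum>v\<in>?V. h_poly (d - 1) (vertex_link \<Delta> v)) = (\<Sum>v\<in>?V. ?f v)"
    by (rule sum_distrib_left)
  have rhs: "of_nat (card ?V) * h_poly d \<Delta> = (\<Sum>v\<in>?V. h_poly d \<Delta>)"
    by simp
  have "(\<Sum>v\<in>?V. ?f v) = (\<Sum>v\<in>?V. h_poly d \<Delta>) \<longleftrightarrow> unique_opposite \<Delta>"
  proof
    assume eq: "(\<Sum>v\<in>?V. ?f v) = (\<Sum>v\<in>?V. h_poly d \<Delta>)"
    \<comment> \<open>The inequality holds at each vertex separately, so equality of the sums forces
      equality term by term.\<close>
    have "?f v = h_poly d \<Delta>" if v: "v \<in> ?V" for v
    proof (rule poly_eqI)
      fix i
      have "(\<Sum>v\<in>?V. coeff (?f v) i) = (\<Sum>v\<in>?V. coeff (h_poly d \<Delta>) i)"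
        unfolding coeff_sum[symmetric] eq ..
      then show "coeff (?f v) i = coeff (h_poly d \<Delta>) i"
        by (rule sum_mono_inv) (use ineq v finV in auto)
    qed
    then show "unique_opposite \<Delta>"
      unfolding unique_opposite_def
      using h_link_eq_imp_unique_opposite[OF flag fin card_le] by blast
  next
    assume "unique_opposite \<Delta>"
    then show "(\<Sum>v\<in>?V. ?f v) = (\<Sum>v\<in>?V. h_poly d \<Delta>)"
      using unique_opposite_imp_h_link_eq[OF flag fin card_le] by (intro sum.cong) auto
  qed
  also have "unique_opposite \<Delta> \<longleftrightarrow>
      (\<exists>B :: 'a set. B \<subseteq> Basis \<and> card B = d \<and> complex_iso \<Delta> (cross_complex B))"
  proof
    assume opp: "unique_opposite \<Delta>"
    \<comment> \<open>The crosspolytope is sought in the ambient space of \<open>P\<close>, which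
      therefore has room for \<open>d\<close> basis vectors.\<close>
    have "d \<le> DIM('a)" using aff_dim_le_DIM[of P] assms(2) by simp
    then obtain B :: "'a set" where "B \<subseteq> Basis" "card B = d"
      by (meson obtain_subset_with_card_n)
    then show "\<exists>B :: 'a set. B \<subseteq> Basis \<and> card B = d \<and> complex_iso \<Delta> (cross_complex B)"
      using unique_opposite_imp_iso[OF flag opp card_le F] by blast
  qed (use unique_opposite_iso unique_opposite_cross_complex flag in blast)
  finally show ?thesis
    unfolding crosspolytope_boundary_iff lhs rhs coeff_sum using ineq by (blast intro: sum_mono)
qed

end
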